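(* Let $q\in\Bbbk$ be nonzero with $q=1$ or $q$ not a root of unity, and let $\mathcal{D}_q$ be the tensor category of finite dimensional right $\Bbbk\mathcal{A}(q)$-comodules with its objects $V(i,l)$, $i\in\mathbb{Z}$, $l\ge 0$. Then for all $s,t\in\mathbb{Z}$ and all integers $l,m\ge 0$ one has, up to isomorphism in $\mathcal{D}_q$, $$V(s,l)\otimes V(t,m)=\bigoplus_{i=0}^{l}V(s+t+i,l+m-2i)=V(t,m)\otimes V(s,l).$$
   Context: $\Bbbk$ is an algebraically closed field of characteristic $0$. For $q\in\Bbbk$ and integers $l,m\ge 0$ put $l_q=1+q+\cdots+q^{l-1}$, $l!_q=1_q\cdots l_q$, and let $\binom{l+m}{l}_q=\frac{(l+m)!_q}{l!_q\,m!_q}$ be the Gaussian binomial coefficient (a polynomial in $q$, evaluated at $q$). For $0\ne q\in\Bbbk$, $\Bbbk\mathcal{A}(q)$ is the Hopf algebra with $\Bbbk$-basis $\{p_i^l\mid i\in\mathbb{Z},\ l\ge 0\}$ ($p_i^l$ is the path of length $l$ starting at vertex $i$ of the infinite linear quiver, with vertex set $\mathbb{Z}$ and one arrow $i\to i+1$ for each $i$), comultiplication $\Delta(p_i^l)=\sum_{j=0}^{l}p_{i+j}^{l-j}\otimes p_i^{j}$, counit $\varepsilon(p_i^l)=\delta_{l,0}$, multiplication $p_i^l\cdot p_j^m=q^{im}\binom{l+m}{l}_q\,p_{i+j}^{l+m}$, and unit $p_0^0$. $\mathcal{D}_q$ is the tensor category of finite dimensional right $\Bbbk\mathcal{A}(q)$-comodules,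 where the comodule structure of $U\otimes V$ is $u\otimes v\mapsto u_0\otimes v_0\otimes u_1v_1$ (Sweedler notation). For $i\in\mathbb{Z}$ and $l\ge 0$, $V(i,l)$ is the right $\Bbbk\mathcal{A}(q)$-comodule with basis $v^i_0,\dots,v^i_l$ and coaction $v^i_m\mapsto\sum_{j=m}^{l}v^i_j\otimes p_{i+m}^{j-m}$.
   Formalization: The direct sum is taken over i from 0 to min(l,m) instead of 0 to l: for l > m the printed sum contains undefined terms V(·, negative), e.g. l=2, m=0, where the left side has dimension 3 and the terms i=0,1 already give 4; for l ≤ m it is unchanged. *)

theory Defs
  imports
    "HOL-Library.Poly_Mapping"
    "HOL-Computational_Algebra.Polynomial"
begin

section \<open>Vector spaces with a basis\<close>

text \<open>
  The type \<open>'b \<Rightarrow>\<^sub>0 'k\<close> of finitely supported functions is the \<open>'k\<close>-vector space with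
  basis \<open>'b\<close>; the basis vector of \<open>b\<close> is \<open>bvec b\<close>. The tensor product of the spaces with
  bases \<open>'a\<close> and \<open>'b\<close> is the space with basis \<open>'a \<times> 'b\<close>.
\<close>

definition scale :: "'k::field \<Rightarrow> ('b \<Rightarrow>\<^sub>0 'k) \<Rightarrow> 'b \<Rightarrow>\<^sub>0 'k"
  where "scale c x = Poly_Mapping.map ((*) c) x"

lemma lookup_scale [simp]: "Poly_Mapping.lookup (scale c x) b = c * Poly_Mapping.lookup x b"
  by (simp add: scale_def Poly_Mapping.map.rep_eq when_def)

lemma vector_space_scale: "vector_space (scale :: 'k::field \<Rightarrow> ('b \<Rightarrow>\<^sub>0 'k) \<Rightarrow> _)"
  by unfold_locales (auto intro!: poly_mapping_eqI simp: lookup_add algebra_simps)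

abbreviation bvec :: "'b \<Rightarrow> 'b \<Rightarrow>\<^sub>0 'k::field"
  where "bvec b \<equiv> Poly_Mapping.single b 1"

text \<open>The linear map with prescribed values on the basis vectors.\<close>

definition lin_ext :: "('b \<Rightarrow> 'c \<Rightarrow>\<^sub>0 'k::field) \<Rightarrow> ('b \<Rightarrow>\<^sub>0 'k) \<Rightarrow> 'c \<Rightarrow>\<^sub>0 'k"
  where "lin_ext f x = (\<Sum>b\<in>Poly_Mapping.keys x. scale (Poly_Mapping.lookup x b) (f b))"

definition tensor_vec :: "('a \<Rightarrow>\<^sub>0 'k::field) \<Rightarrow> ('b \<Rightarrow>\<^sub>0 'k) \<Rightarrow> ('a \<times> 'b) \<Rightarrow>\<^sub>0 'k"
  where "tensor_vec x y =
    (\<Sum>a\<in>Poly_Mapping.keys x. \<Sum>b\<in>Poly_Mapping.keys y.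
      Poly_Mapping.single (a, b) (Poly_Mapping.lookup x a * Poly_Mapping.lookup y b))"

definition tensor_map ::
  "(('a \<Rightarrow>\<^sub>0 'k::field) \<Rightarrow> 'c \<Rightarrow>\<^sub>0 'k) \<Rightarrow> (('b \<Rightarrow>\<^sub>0 'k) \<Rightarrow> 'd \<Rightarrow>\<^sub>0 'k)
    \<Rightarrow> (('a \<times> 'b) \<Rightarrow>\<^sub>0 'k) \<Rightarrow> ('c \<times> 'd) \<Rightarrow>\<^sub>0 'k"
  where "tensor_map F G = lin_ext (\<lambda>(a, b). tensor_vec (F (bvec a)) (G (bvec b)))"

definition tensor_assoc :: "((('a \<times> 'b) \<times> 'c) \<Rightarrow>\<^sub>0 'k::field) \<Rightarrow> ('a \<times> 'b \<times> 'c) \<Rightarrow>\<^sub>0 'k"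
  where "tensor_assoc = lin_ext (\<lambda>((a, b), c). bvec (a, b, c))"


section \<open>Gaussian binomial coefficients\<close>

definition qnum :: "'a::comm_semiring_1 \<Rightarrow> nat \<Rightarrow> 'a"
  where "qnum q l = (\<Sum>i<l. q ^ i)"

definition qfact :: "'a::comm_semiring_1 \<Rightarrow> nat \<Rightarrow> 'a"
  where "qfact q l = (\<Prod>i=1..l. qnum q i)"

text \<open>
  \<open>qbinom q l m\<close> is \<open>(l+m)!\<^sub>q / (l!\<^sub>q m!\<^sub>q)\<close>. The (exact) division is carried out on polynomials
  in the indeterminate \<open>[:0, 1:]\<close> before evaluating at \<open>q\<close>, because \<open>l!\<^sub>q\<close> may vanish.
\<close>

definition qbinom :: "'k::field \<Rightarrow> nat \<Rightarrow> nat \<Rightarrow> 'k"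
  where "qbinom q l m =
    poly (qfact [:0, 1:] (l + m) div (qfact [:0, 1:] l * qfact [:0, 1:] m)) q"


section \<open>The Hopf algebra \<open>\<bbbk>\<A>(q)\<close>\<close>

text \<open>
  The path \<open>p\<^sub>i\<^sup>l\<close> is the pair \<open>(i, l)\<close>. The unit \<open>p\<^sub>0\<^sup>0\<close> and the antipode are not needed to form
  comodules and their tensor products.
\<close>

type_synonym path = "int \<times> nat"

definition kA_comult :: "(path \<Rightarrow>\<^sub>0 'k::field) \<Rightarrow> (path \<times> path) \<Rightarrow>\<^sub>0 'k"
  where "kA_comult = lin_ext (\<lambda>(i, l). \<Sum>j\<le>l. bvec ((i + int j, l - j), (i, j)))"

definition kA_counit :: "(path \<Rightarrow>\<^sub>0 'k::field) \<Rightarrow> 'k"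
  where "kA_counit x = (\<Sum>(i, l)\<in>Poly_Mapping.keys x.
    Poly_Mapping.lookup x (i, l) * (if l = 0 then 1 else 0))"

definition kA_mult :: "'k::field \<Rightarrow> ((path \<times> path) \<Rightarrow>\<^sub>0 'k) \<Rightarrow> path \<Rightarrow>\<^sub>0 'k"
  where "kA_mult q = lin_ext (\<lambda>((i, l), (j, m)).
    scale (q powi (i * int m) * qbinom q l m) (bvec (i + j, l + m)))"


section \<open>Finite dimensional right comodules\<close>

text \<open>
  A finite dimensional comodule is given on a vector space with a chosen finite basis, namely
  the subset \<open>basis M\<close> of the type \<open>'b\<close>; \<open>coact_basis M\<close> is the coaction on basis vectors.
\<close>

record (overloaded) ('b, 'k) comod =
  basis :: "'b set"
  coact_basis :: "'b \<Rightarrow> ('b \<times> path) \<Rightarrow>\<^sub>0 'k"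

definition comod_space :: "('b, 'k::field) comod \<Rightarrow> ('b \<Rightarrow>\<^sub>0 'k) set"
  where "comod_space M = {x. Poly_Mapping.keys x \<subseteq> basis M}"

definition coact :: "('b, 'k::field) comod \<Rightarrow> ('b \<Rightarrow>\<^sub>0 'k) \<Rightarrow> ('b \<times> path) \<Rightarrow>\<^sub>0 'k"
  where "coact M = lin_ext (coact_basis M)"

text \<open>The last condition is \<open>(id \<otimes> \<epsilon>) \<circ> \<rho> = id\<close>, with \<open>V \<otimes> \<bbbk>\<close> identified with \<open>V\<close>.\<close>

definition is_comodule :: "('b, 'k::field) comod \<Rightarrow> bool"
  where "is_comodule M \<longleftrightarrow>
    finite (basis M) \<and>
    (\<forall>x\<in>comod_space M. Poly_Mapping.keys (coact M x) \<subseteq> basis M \<times> UNIV) \<and>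
    (\<forall>x\<in>comod_space M. tensor_assoc (tensor_map (coact M) id (coact M x))
                  = tensor_map id kA_comult (coact M x)) \<and>
    (\<forall>x\<in>comod_space M. lin_ext (\<lambda>(b, p). scale (kA_counit (bvec p)) (bvec b)) (coact M x) = x)"

definition comod_hom ::
  "('b, 'k::field) comod \<Rightarrow> ('c, 'k) comod \<Rightarrow> (('b \<Rightarrow>\<^sub>0 'k) \<Rightarrow> 'c \<Rightarrow>\<^sub>0 'k) \<Rightarrow> bool"
  where "comod_hom M N F \<longleftrightarrow>
    Vector_Spaces.linear scale scale F \<and> F ` comod_space M \<subseteq> comod_space N \<and>
    (\<forall>x\<in>comod_space M. coact N (F x) = tensor_map F id (coact M x))"

definition comod_iso :: "('b, 'k::field) comod \<Rightarrow> ('c, 'k) comod \<Rightarrow> bool"  (infix "\<cong>\<^sub>c" 50)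
  where "M \<cong>\<^sub>c N \<longleftrightarrow> is_comodule M \<and> is_comodule N \<and>
    (\<exists>F. comod_hom M N F \<and> bij_betw F (comod_space M) (comod_space N))"

text \<open>\<open>u \<otimes> v \<mapsto> u\<^sub>0 \<otimes> v\<^sub>0 \<otimes> u\<^sub>1v\<^sub>1\<close>; only the product, hence only the tensor product, depends on \<open>q\<close>.\<close>

definition comod_tensor ::
  "'k::field \<Rightarrow> ('b, 'k) comod \<Rightarrow> ('c, 'k) comod \<Rightarrow> ('b \<times> 'c, 'k) comod"
  where "comod_tensor q M N = \<lparr>
    basis = basis M \<times> basis N,
    coact_basis = (\<lambda>(u, v).
      lin_ext (\<lambda>((u0, u1), (v0, v1)). tensor_vec (bvec (u0, v0)) (kA_mult q (bvec (u1, v1))))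
        (tensor_vec (coact_basis M u) (coact_basis N v)))\<rparr>"

definition comod_dsum :: "'i set \<Rightarrow> ('i \<Rightarrow> ('b, 'k::field) comod) \<Rightarrow> ('i \<times> 'b, 'k) comod"
  where "comod_dsum I M = \<lparr>
    basis = (SIGMA i:I. basis (M i)),
    coact_basis = (\<lambda>(i, b). lin_ext (\<lambda>(b', p). bvec ((i, b'), p)) (coact_basis (M i) b))\<rparr>"

text \<open>The basis vector \<open>v\<^sup>i\<^sub>m\<close> of \<open>V(i,l)\<close> is the natural number \<open>m\<close>.\<close>

definition V :: "int \<Rightarrow> nat \<Rightarrow> (nat, 'k::field) comod"
  where "V i l = \<lparr>
    basis = {0..l},
    coact_basis = (\<lambda>m. \<Sum>j=m..l. bvec (j, (i + int m, j - m)))\<rparr>"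

end

theory Submission
  imports Defs
begin

text \<open>
  A comodule is a graded vector space with a nilpotent operator \<open>X\<close> of degree 1, and \<open>V(i,l)\<close> is a
  single string of length \<open>l + 1\<close> starting in degree \<open>i\<close>. On \<open>V(s,l) \<otimes> V(t,m)\<close> the operator is
  \<open>X(u\<^sub>a \<otimes> v\<^sub>b) = u\<^sub>a\<^sub>+\<^sub>1 \<otimes> v\<^sub>b + q\<^sup>s\<^sup>+\<^sup>a u\<^sub>a \<otimes> v\<^sub>b\<^sub>+\<^sub>1\<close>. The vector \<open>u\<^sub>0 \<otimes> v\<^sub>0\<close> generates a string of length
  \<open>l + m + 1\<close>, because the coefficient of \<open>u\<^sub>l \<otimes> v\<^sub>m\<close> in \<open>X\<^sup>l\<^sup>+\<^sup>m(u\<^sub>0 \<otimes> v\<^sub>0)\<close> is a power of \<open>q\<close> times a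
  Gaussian binomial coefficient, which is nonzero. The map
  \<open>u\<^sub>a \<otimes> v\<^sub>b \<mapsto> q\<^sup>b (m-b)\<^sub>q u\<^sub>a\<^sub>+\<^sub>1 \<otimes> v\<^sub>b - q\<^sup>m\<^sup>+\<^sup>s\<^sup>+\<^sup>a (l-a)\<^sub>q u\<^sub>a \<otimes> v\<^sub>b\<^sub>+\<^sub>1\<close> is an injection of
  \<open>V(s,l-1) \<otimes> V(t+1,m-1)\<close> into \<open>V(s,l) \<otimes> V(t,m)\<close> commuting with \<open>X\<close>. Iterating it gives, for each
  \<open>i \<le> min l m\<close>, a string of length \<open>l + m - 2i + 1\<close> starting in degree \<open>s + t + i\<close>. Strings with
  nonzero ends in distinct degrees are independent, and their lengths add up to \<open>(l+1)(m+1)\<close>.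
\<close>

section \<open>Linear algebra on finitely supported functions\<close>

interpretation pm: vector_space "scale :: 'k::field \<Rightarrow> ('b \<Rightarrow>\<^sub>0 'k) \<Rightarrow> _"
  by (rule vector_space_scale)

interpretation pmp: vector_space_pair "scale :: 'k::field \<Rightarrow> ('b \<Rightarrow>\<^sub>0 'k) \<Rightarrow> _"
    "scale :: 'k::field \<Rightarrow> ('c \<Rightarrow>\<^sub>0 'k) \<Rightarrow> _"
  by (simp add: vector_space_pair_def vector_space_scale)

text \<open>The terms outside the support vanish, so one fixed finite index set can serve several
  vectors at once; all later interchanges of sums rely on this.\<close>

lemma lookup_lin_ext_superset:
  assumes "finite A" "Poly_Mapping.keys x \<subseteq> A"
  shows "Poly_Mapping.lookup (lin_ext f x) c
    = (\<Sum>b\<in>A. Poly_Mapping.lookup x b * Poly_Mapping.lookup (f b) c)"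
proof -
  have "Poly_Mapping.lookup (lin_ext f x) c
      = (\<Sum>b\<in>Poly_Mapping.keys x. Poly_Mapping.lookup x b * Poly_Mapping.lookup (f b) c)"
    by (simp add: lin_ext_def lookup_sum)
  also have "\<dots> = (\<Sum>b\<in>A. Poly_Mapping.lookup x b * Poly_Mapping.lookup (f b) c)"
    using assms by (intro sum.mono_neutral_left) (auto simp: in_keys_iff)
  finally show ?thesis .
qed

lemma pm_linearI:
  fixes F :: "('b \<Rightarrow>\<^sub>0 'k::field) \<Rightarrow> 'c \<Rightarrow>\<^sub>0 'k"
  assumes "\<And>x y. F (x + y) = F x + F y" "\<And>r x. F (scale r x) = scale r (F x)"
  shows "Vector_Spaces.linear scale scale F"
  using assms by (simp add: Vector_Spaces.linear_iff vector_space_scale)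

lemma lin_ext_linear:
  fixes f :: "'b \<Rightarrow> 'c \<Rightarrow>\<^sub>0 'k::field"
  shows "Vector_Spaces.linear scale scale (lin_ext f)"
proof (intro pm_linearI poly_mapping_eqI)
  fix x y :: "'b \<Rightarrow>\<^sub>0 'k" and c
  show "Poly_Mapping.lookup (lin_ext f (x + y)) c
      = Poly_Mapping.lookup (lin_ext f x + lin_ext f y) c"
    unfolding lookup_add
    using keys_add[of x y]
    by (simp add: lookup_lin_ext_superset[of "Poly_Mapping.keys x \<union> Poly_Mapping.keys y"]
        lookup_add sum.distrib distrib_right)
next
  fix r :: 'k and x :: "'b \<Rightarrow>\<^sub>0 'k" and c
  have "Poly_Mapping.keys (scale r x) \<subseteq> Poly_Mapping.keys x"
    by (auto simp: in_keys_iff)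
  then show "Poly_Mapping.lookup (lin_ext f (scale r x)) c
      = Poly_Mapping.lookup (scale r (lin_ext f x)) c"
    by (simp add: lookup_lin_ext_superset[of "Poly_Mapping.keys x"] sum_distrib_left mult.assoc)
qed

lemma lin_ext_bvec [simp]: "lin_ext f (bvec b) = f b"
  by (rule poly_mapping_eqI) (simp add: lookup_lin_ext_superset[of "{b}"])

lemma lin_ext_sum: "lin_ext f (sum g A) = (\<Sum>a\<in>A. lin_ext f (g a))"
  by (rule pmp.linear_sum[OF lin_ext_linear])

lemma linear_eq_lin_ext:
  fixes F :: "('b \<Rightarrow>\<^sub>0 'k::field) \<Rightarrow> 'c \<Rightarrow>\<^sub>0 'k"
  assumes "Vector_Spaces.linear scale scale F"
  shows "F = lin_ext (\<lambda>b. F (bvec b))"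
proof
  fix x :: "'b \<Rightarrow>\<^sub>0 'k"
  have "x = lin_ext bvec x"
  proof (rule poly_mapping_eqI)
    fix c
    show "Poly_Mapping.lookup x c = Poly_Mapping.lookup (lin_ext bvec x) c"
      by (subst lookup_lin_ext_superset[of "insert c (Poly_Mapping.keys x)"])
        (auto simp: lookup_single when_def if_distrib cong: if_cong)
  qed
  then have "F x = F (lin_ext bvec x)" by simp
  also have "\<dots> = lin_ext (\<lambda>b. F (bvec b)) x"
    unfolding lin_ext_def
    by (simp add: pmp.linear_sum[OF assms] pmp.linear_scale[OF assms])
  finally show "F x = lin_ext (\<lambda>b. F (bvec b)) x" .
qed

lemma lookup_tensor_vec [simp]:
  "Poly_Mapping.lookup (tensor_vec x y) (a, b) = Poly_Mapping.lookup x a * Poly_Mapping.lookup y b"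
proof -
  have "Poly_Mapping.lookup (tensor_vec x y) (a, b)
    = (\<Sum>a'\<in>Poly_Mapping.keys x. \<Sum>b'\<in>Poly_Mapping.keys y.
        if a' = a then if b' = b then Poly_Mapping.lookup x a * Poly_Mapping.lookup y b else 0 else 0)"
    unfolding tensor_vec_def lookup_sum by (intro sum.cong refl) (auto simp: lookup_single when_def)
  also have "\<dots> = (\<Sum>a'\<in>Poly_Mapping.keys x. if a' = a then 
       (\<Sum>b'\<in>Poly_Mapping.keys y. if b' = b then Poly_Mapping.lookup x a * Poly_Mapping.lookup y b else 0) else 0)"
    by (intro sum.cong) auto
  also have "\<dots> = Poly_Mapping.lookup x a * Poly_Mapping.lookup y b"
    by (auto simp: in_keys_iff)
  finally show ?thesis .
qed

lemma tensor_vec_bvec [simp]: "tensor_vec (bvec a) (bvec b) = bvec (a, b)"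
  by (rule poly_mapping_eqI) (auto simp: lookup_single when_def split: prod.splits if_splits)

lemma tensor_vec_sum_left: "tensor_vec (sum f A) y = (\<Sum>a\<in>A. tensor_vec (f a) y)"
  by (rule poly_mapping_eqI) (auto simp: lookup_sum sum_distrib_right)

lemma tensor_vec_sum_right: "tensor_vec x (sum f A) = (\<Sum>a\<in>A. tensor_vec x (f a))"
  by (rule poly_mapping_eqI) (auto simp: lookup_sum sum_distrib_left)

lemma tensor_vec_scale_right: "tensor_vec x (scale r y) = scale r (tensor_vec x y)"
  by (rule poly_mapping_eqI) auto

text \<open>The identity factor fixes the second index, so only a finite matrix product in the first
  index remains. Comodule identities are checked in this form.\<close>

lemma lookup_tensor_map_id_right:
  assumes "finite A" "Poly_Mapping.keys z \<subseteq> A \<times> UNIV"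
  shows "Poly_Mapping.lookup (tensor_map F id z) (c, r)
    = (\<Sum>e\<in>A. Poly_Mapping.lookup z (e, r) * Poly_Mapping.lookup (F (bvec e)) c)"
proof -
  \<comment> \<open>The set of all paths is infinite; \<open>r\<close> is inserted so that the final
    Kronecker sum meets it even when \<open>r\<close> does not occur in \<open>z\<close>.\<close>
  let ?R = "insert r (snd ` Poly_Mapping.keys z)"
  have "Poly_Mapping.keys z \<subseteq> A \<times> ?R"
    using assms(2) by force
  then have "Poly_Mapping.lookup (tensor_map F id z) (c, r)
     = (\<Sum>e\<in>A. \<Sum>r'\<in>?R. Poly_Mapping.lookup z (e, r') *
           (Poly_Mapping.lookup (F (bvec e)) c * Poly_Mapping.lookup (bvec r') r))"
    unfolding tensor_map_def
    by (subst lookup_lin_ext_superset[of "A \<times> ?R"])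
      (auto simp: assms sum.cartesian_product intro!: sum.cong)
  also have "\<dots> = (\<Sum>e\<in>A. \<Sum>r'\<in>?R. if r' = r then
      Poly_Mapping.lookup z (e, r) * Poly_Mapping.lookup (F (bvec e)) c else 0)"
    by (intro sum.cong refl) (auto simp: lookup_single when_def)
  finally show ?thesis by simp
qed

lemma lookup_tensor_map_id_left:
  assumes "finite A" "Poly_Mapping.keys z \<subseteq> UNIV \<times> A"
  shows "Poly_Mapping.lookup (tensor_map id G z) (r, c)
    = (\<Sum>e\<in>A. Poly_Mapping.lookup z (r, e) * Poly_Mapping.lookup (G (bvec e)) c)"
proof -
  let ?R = "insert r (fst ` Poly_Mapping.keys z)"
  have "Poly_Mapping.keys z \<subseteq> ?R \<times> A"
    using assms(2) by force
  then have "Poly_Mapping.lookup (tensor_map id G z) (r, c)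
     = (\<Sum>r'\<in>?R. \<Sum>e\<in>A. Poly_Mapping.lookup z (r', e) *
           (Poly_Mapping.lookup (bvec r') r * Poly_Mapping.lookup (G (bvec e)) c))"
    unfolding tensor_map_def
    by (subst lookup_lin_ext_superset[of "?R \<times> A"])
      (auto simp: assms sum.cartesian_product intro!: sum.cong)
  also have "\<dots> = (\<Sum>r'\<in>?R. if r' = r then
      (\<Sum>e\<in>A. Poly_Mapping.lookup z (r, e) * Poly_Mapping.lookup (G (bvec e)) c) else 0)"
    by (intro sum.cong refl) (auto simp: lookup_single when_def)
  finally show ?thesis by simp
qed

lemma lookup_tensor_assoc [simp]:
  "Poly_Mapping.lookup (tensor_assoc z) (a, b, c) = Poly_Mapping.lookup z ((a, b), c)"
proof -
  have "Poly_Mapping.lookup (tensor_assoc z) (a, b, c)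
    = (\<Sum>e\<in>insert ((a, b), c) (Poly_Mapping.keys z).
        if e = ((a, b), c) then Poly_Mapping.lookup z e else 0)"
    unfolding tensor_assoc_def
    by (subst lookup_lin_ext_superset[of "insert ((a, b), c) (Poly_Mapping.keys z)"], simp, blast,
        intro sum.cong refl) (auto simp: lookup_single when_def split: if_splits)
  then show ?thesis by simp
qed

text \<open>A path is cut at one point, which \<open>l2\<close> determines. The left tensor factor
  is the later piece, hence starts at \<open>i + int l2\<close>.\<close>

lemma lookup_kA_comult_bvec:
  "Poly_Mapping.lookup (kA_comult (bvec (i, l))) ((i1, l1), (i2, l2))
    = (if i2 = i \<and> i1 = i + int l2 \<and> l = l1 + l2 then 1 else 0)"
proof -
  have "Poly_Mapping.lookup (kA_comult (bvec (i, l))) ((i1, l1), (i2, l2))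
    = (\<Sum>j\<le>l. if j = l2 then if i2 = i \<and> i1 = i + int l2 \<and> l = l1 + l2 then 1 else 0 else 0)"
    unfolding kA_comult_def
    unfolding lin_ext_bvec prod.case lookup_sum
    by (intro sum.cong refl) (auto simp: lookup_single when_def)
  then show ?thesis by auto
qed

lemma kA_counit_bvec [simp]: "kA_counit (bvec (i, l)) = (if l = 0 then 1 else 0)"
  by (simp add: kA_counit_def)

section \<open>Comodules as nilpotent operators of degree one\<close>

text \<open>
  A \<open>\<bbbk>\<A>(q)\<close>-comodule is a graded vector space with a locally nilpotent operator \<open>X\<close> of degree 1,
  with coaction \<open>v \<mapsto> \<Sum>\<^sub>n X\<^sup>n v \<otimes> p\<^sub>d\<^sup>n\<close> for \<open>v\<close> of degree \<open>d\<close>; \<open>C n\<close> is the matrix of \<open>X\<^sup>n\<close>,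
  where \<open>C n b c\<close> is the coefficient of \<open>c\<close> in \<open>X\<^sup>n b\<close>.
\<close>

locale graded_comod =
  fixes M :: "('b, 'k::field) comod" and deg :: "'b \<Rightarrow> int" and C :: "nat \<Rightarrow> 'b \<Rightarrow> 'b \<Rightarrow> 'k"
  assumes finite_basis: "finite (basis M)"
    and lookup_coact_basis: "b \<in> basis M \<Longrightarrow>
      Poly_Mapping.lookup (coact_basis M b) (c, (i, n)) = (if i = deg b then C n b c else 0)"
    and C_in_basis: "b \<in> basis M \<Longrightarrow> C n b c \<noteq> 0 \<Longrightarrow> c \<in> basis M"
    and C_deg: "b \<in> basis M \<Longrightarrow> C n b c \<noteq> 0 \<Longrightarrow> deg c = deg b + int n"
    and C_0: "b \<in> basis M \<Longrightarrow> C 0 b c = (if b = c then 1 else 0)"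
    and C_add: "b \<in> basis M \<Longrightarrow> C (n + k) b c = (\<Sum>e\<in>basis M. C n b e * C k e c)"
begin

lemma lookup_coact:
  assumes "x \<in> comod_space M"
  shows "Poly_Mapping.lookup (coact M x) (c, (i, n))
    = (\<Sum>b\<in>basis M. Poly_Mapping.lookup x b * (if i = deg b then C n b c else 0))"
  using assms finite_basis
  by (simp add: coact_def comod_space_def lookup_lin_ext_superset[of "basis M"] lookup_coact_basis)

lemma lookup_coact_bvec:
  "b \<in> basis M \<Longrightarrow>
    Poly_Mapping.lookup (coact M (bvec b)) (c, (i, n)) = (if i = deg b then C n b c else 0)"
  by (simp add: coact_def lookup_coact_basis)

lemma keys_coact:
  assumes "x \<in> comod_space M"
  shows "Poly_Mapping.keys (coact M x) \<subseteq> basis M \<times> UNIV"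
proof
  fix k assume k: "k \<in> Poly_Mapping.keys (coact M x)"
  obtain c i n where k': "k = (c, (i, n))" by (metis prod.exhaust)
  from k have "(\<Sum>b\<in>basis M. Poly_Mapping.lookup x b * (if i = deg b then C n b c else 0)) \<noteq> 0"
    using assms by (simp add: k' in_keys_iff lookup_coact)
  then obtain b where "b \<in> basis M" "C n b c \<noteq> 0"
    by (rule sum.not_neutral_contains_not_neutral) (auto split: if_splits)
  then show "k \<in> basis M \<times> UNIV" using C_in_basis k' by auto
qed

text \<open>Coassociativity amounts to \<open>C_add\<close>; \<open>C_deg\<close> supplies the
  vertex condition \<open>i1 = i2 + int l2\<close> under which the two paths concatenate.\<close>

lemma coact_coassoc:
  assumes x: "x \<in> comod_space M"
  shows "tensor_assoc (tensor_map (coact M) id (coact M x)) = tensor_map id kA_comult (coact M x)"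
proof (rule poly_mapping_eqI)
  fix z :: "'b \<times> path \<times> path"
  obtain c i1 l1 i2 l2 where z: "z = (c, (i1, l1), (i2, l2))" by (metis prod.exhaust)
  let ?x = "Poly_Mapping.lookup x"
  \<comment> \<open>The inserted path is the only one whose comultiplication can contain the pair
    \<open>((i1, l1), (i2, l2))\<close>.\<close>
  let ?P = "insert (i2, l1 + l2) (snd ` Poly_Mapping.keys (coact M x))"
  have "Poly_Mapping.lookup (tensor_assoc (tensor_map (coact M) id (coact M x))) z
    = (\<Sum>e\<in>basis M. (\<Sum>b\<in>basis M. ?x b * (if i2 = deg b then C l2 b e else 0)) *
         (if i1 = deg e then C l1 e c else 0))"
    by (simp add: z lookup_tensor_map_id_right[OF finite_basis keys_coact[OF x]]
        lookup_coact[OF x] lookup_coact_bvec)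
  also have "\<dots> = (\<Sum>b\<in>basis M. \<Sum>e\<in>basis M. ?x b * (if i2 = deg b then C l2 b e else 0) *
         (if i1 = deg e then C l1 e c else 0))"
    by (subst sum.swap) (simp add: sum_distrib_right)
  also have "\<dots> = (\<Sum>b\<in>basis M. if i2 = deg b \<and> i1 = i2 + int l2 then
      ?x b * (\<Sum>e\<in>basis M. C l2 b e * C l1 e c) else 0)"
  proof (rule sum.cong[OF refl])
    fix b assume b: "b \<in> basis M"
    show "(\<Sum>e\<in>basis M. ?x b * (if i2 = deg b then C l2 b e else 0) *
         (if i1 = deg e then C l1 e c else 0)) = (if i2 = deg b \<and> i1 = i2 + int l2 then
      ?x b * (\<Sum>e\<in>basis M. C l2 b e * C l1 e c) else 0)"
      unfolding sum_distrib_left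
      using C_deg[OF b] by (auto simp: mult.assoc intro!: sum.cong sum.neutral) (metis)+
  qed
  also have "\<dots> = (\<Sum>b\<in>basis M. if i2 = deg b \<and> i1 = i2 + int l2 then ?x b * C (l1 + l2) b c else 0)"
    by (intro sum.cong refl) (simp add: C_add[symmetric] add.commute)
  also have "\<dots> = (if i1 = i2 + int l2 then Poly_Mapping.lookup (coact M x) (c, (i2, l1 + l2)) else 0)"
    by (auto simp: lookup_coact[OF x] intro!: sum.cong)
  also have "\<dots> = (\<Sum>p\<in>?P. if p = (i2, l1 + l2) then
      if i1 = i2 + int l2 then Poly_Mapping.lookup (coact M x) (c, (i2, l1 + l2)) else 0 else 0)"
    by simp
  also have "\<dots> = (\<Sum>p\<in>?P. Poly_Mapping.lookup (coact M x) (c, p) *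
      Poly_Mapping.lookup (kA_comult (bvec p)) ((i1, l1), (i2, l2)))"
    by (intro sum.cong refl) (auto simp: lookup_kA_comult_bvec split: prod.splits if_splits)
  also have "\<dots> = Poly_Mapping.lookup (tensor_map id kA_comult (coact M x)) z"
    unfolding z by (rule lookup_tensor_map_id_left[symmetric]) force+
  finally show "Poly_Mapping.lookup (tensor_assoc (tensor_map (coact M) id (coact M x))) z
    = Poly_Mapping.lookup (tensor_map id kA_comult (coact M x)) z" .
qed

text \<open>Only paths of length 0 survive the counit, and \<open>C 0\<close> is the identity matrix
  on the basis.\<close>

lemma coact_counit:
  assumes x: "x \<in> comod_space M"
  shows "lin_ext (\<lambda>(b, p). scale (kA_counit (bvec p)) (bvec b)) (coact M x) = x"
proof (rule poly_mapping_eqI)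
  fix c
  let ?z = "Poly_Mapping.lookup (coact M x)"
  let ?K = "insert (c, (deg c, 0)) (Poly_Mapping.keys (coact M x))"
  have z0: "?z (c, (i, 0)) = (if i = deg c then Poly_Mapping.lookup x c else 0)" for i
  proof -
    have "?z (c, (i, 0)) = (\<Sum>b\<in>basis M. if b = c then
        if i = deg c then Poly_Mapping.lookup x c else 0 else 0)"
      unfolding lookup_coact[OF x] by (intro sum.cong refl) (auto simp: C_0)
    also have "\<dots> = (if i = deg c then Poly_Mapping.lookup x c else 0)"
      using x finite_basis by (auto simp: comod_space_def in_keys_iff)
    finally show ?thesis .
  qed
  have "Poly_Mapping.lookup (lin_ext (\<lambda>(b, p). scale (kA_counit (bvec p)) (bvec b)) (coact M x)) c
    = (\<Sum>k\<in>?K. if k = (c, (deg c, 0)) then Poly_Mapping.lookup x c else 0)"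
    by (subst lookup_lin_ext_superset[of ?K], simp, blast, intro sum.cong refl)
      (auto simp: z0 lookup_single when_def split: prod.splits if_splits)
  then show "Poly_Mapping.lookup (lin_ext (\<lambda>(b, p). scale (kA_counit (bvec p)) (bvec b)) (coact M x)) c
    = Poly_Mapping.lookup x c" by simp
qed

lemma is_comodule: "is_comodule M"
  unfolding is_comodule_def using finite_basis keys_coact coact_coassoc coact_counit by blast

end

section \<open>Homomorphisms, inverses and dimension counting\<close>

lemma lin_ext_in_comod_space:
  assumes "\<And>b. b \<in> basis M \<Longrightarrow> Poly_Mapping.keys (f b) \<subseteq> basis N" "x \<in> comod_space M"
  shows "lin_ext f x \<in> comod_space N"
proof -
  have "Poly_Mapping.lookup (lin_ext f x) c = 0" if "c \<notin> basis N" for c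
    unfolding lookup_lin_ext_superset[OF finite_keys subset_refl]
    using that assms by (intro sum.neutral) (auto simp: comod_space_def in_keys_iff subset_iff)
  then show ?thesis by (auto simp: comod_space_def in_keys_iff)
qed

text \<open>It is enough to preserve degrees and to intertwine all powers of \<open>X\<close>: the
  degree condition turns the starting vertex \<open>deg' e\<close> of a path into
  \<open>deg b\<close>.\<close>

lemma comod_hom_lin_ext:
  assumes "graded_comod M deg C" "graded_comod N deg' D"
    and f_basis: "\<And>b. b \<in> basis M \<Longrightarrow> Poly_Mapping.keys (f b) \<subseteq> basis N"
    and f_deg: "\<And>b c. b \<in> basis M \<Longrightarrow> c \<in> Poly_Mapping.keys (f b) \<Longrightarrow> deg' c = deg b"
    and f_C: "\<And>b c n. b \<in> basis M \<Longrightarrow> (\<Sum>e\<in>basis M. C n b e * Poly_Mapping.lookup (f e) c)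
      = (\<Sum>e\<in>basis N. Poly_Mapping.lookup (f b) e * D n e c)"
  shows "comod_hom M N (lin_ext f)"
  unfolding comod_hom_def
proof (intro conjI ballI)
  interpret M: graded_comod M deg C by fact
  interpret N: graded_comod N deg' D by fact
  show "Vector_Spaces.linear scale scale (lin_ext f)" by (rule lin_ext_linear)
  show "lin_ext f ` comod_space M \<subseteq> comod_space N"
    using lin_ext_in_comod_space[of M f N] f_basis by blast
  fix x assume x: "x \<in> comod_space M"
  let ?x = "Poly_Mapping.lookup x"
  have Fx: "lin_ext f x \<in> comod_space N"
    using lin_ext_in_comod_space[of M f N] f_basis x by blast
  show "coact N (lin_ext f x) = tensor_map (lin_ext f) id (coact M x)"
  proof (rule poly_mapping_eqI)
    fix z :: "'c \<times> path"
    obtain c i n where z: "z = (c, (i, n))" by (metis prod.exhaust)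
    have "Poly_Mapping.lookup (coact N (lin_ext f x)) z
      = (\<Sum>e\<in>basis N. (\<Sum>b\<in>basis M. ?x b * Poly_Mapping.lookup (f b) e)
          * (if i = deg' e then D n e c else 0))"
      using x M.finite_basis
      unfolding z N.lookup_coact[OF Fx]
      by (simp add: lookup_lin_ext_superset[of "basis M"] comod_space_def)
    also have "\<dots> = (\<Sum>b\<in>basis M. \<Sum>e\<in>basis N. ?x b * Poly_Mapping.lookup (f b) e
          * (if i = deg' e then D n e c else 0))"
      by (subst sum.swap) (simp add: sum_distrib_right)
    also have "\<dots> = (\<Sum>b\<in>basis M. ?x b * (if i = deg b then
        \<Sum>e\<in>basis N. Poly_Mapping.lookup (f b) e * D n e c else 0))"
    proof (rule sum.cong[OF refl])
      fix b assume b: "b \<in> basis M"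
      have "Poly_Mapping.lookup (f b) e * (if i = deg' e then D n e c else 0)
        = (if i = deg b then Poly_Mapping.lookup (f b) e * D n e c else 0)" for e
        using f_deg[OF b, of e] by (cases "Poly_Mapping.lookup (f b) e = 0") (auto simp: in_keys_iff)
      then show "(\<Sum>e\<in>basis N. ?x b * Poly_Mapping.lookup (f b) e
          * (if i = deg' e then D n e c else 0)) = ?x b * (if i = deg b then
        \<Sum>e\<in>basis N. Poly_Mapping.lookup (f b) e * D n e c else 0)"
        by (simp add: mult.assoc sum_distrib_left)
    qed
    also have "\<dots> = (\<Sum>b\<in>basis M. ?x b * (if i = deg b then
        \<Sum>e\<in>basis M. C n b e * Poly_Mapping.lookup (f e) c else 0))"
      by (intro sum.cong refl) (simp add: f_C)
    also have "\<dots> = (\<Sum>b\<in>basis M. \<Sum>e\<in>basis M. ?x b * (if i = deg b then C n b e else 0)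
         * Poly_Mapping.lookup (f e) c)"
      by (intro sum.cong refl) (simp add: sum_distrib_left mult.assoc)
    also have "\<dots> = (\<Sum>e\<in>basis M. (\<Sum>b\<in>basis M. ?x b * (if i = deg b then C n b e else 0))
         * Poly_Mapping.lookup (f e) c)"
      by (subst sum.swap) (simp add: sum_distrib_right)
    also have "\<dots> = Poly_Mapping.lookup (tensor_map (lin_ext f) id (coact M x)) z"
      by (simp add: z lookup_tensor_map_id_right[OF M.finite_basis M.keys_coact[OF x]]
          M.lookup_coact[OF x])
    finally show "Poly_Mapping.lookup (coact N (lin_ext f x)) z
      = Poly_Mapping.lookup (tensor_map (lin_ext f) id (coact M x)) z" .
  qed
qed

lemma subspace_comod_space: "pm.subspace (comod_space M)"
  by (rule pm.subspaceI) (auto simp: comod_space_def in_keys_iff lookup_add subset_iff, metis add_0)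

text \<open>Linearity is required on the whole function space, while \<open>F\<close> is bijective
  only between the subspaces. So a linear left inverse \<open>G\<close> on the whole space is used;
  it is the inverse on \<open>comod_space N\<close>.\<close>

lemma comod_iso_sym:
  assumes "M \<cong>\<^sub>c N"
  shows "N \<cong>\<^sub>c M"
proof -
  from assms obtain F where M: "is_comodule M" and N: "is_comodule N"
    and F: "comod_hom M N F" and bij: "bij_betw F (comod_space M) (comod_space N)"
    unfolding comod_iso_def by blast
  have lin: "Vector_Spaces.linear scale scale F" using F by (simp add: comod_hom_def)
  obtain G where G: "Vector_Spaces.linear scale scale G"
    and GF: "\<And>x. x \<in> comod_space M \<Longrightarrow> G (F x) = x"
    using pmp.linear_exists_left_inverse_on[OF lin subspace_comod_space bij_betw_imp_inj_on[OF bij]]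
    by metis
  have bij': "bij_betw G (comod_space N) (comod_space M)"
    unfolding bij_betw_imp_surj_on[OF bij, symmetric]
    by (rule bij_betw_byWitness[where f' = F]) (auto simp: GF)
  have "coact M (G y) = tensor_map G id (coact N y)" if y: "y \<in> comod_space N" for y
  proof -
    obtain x where x: "x \<in> comod_space M" and y: "y = F x"
      using bij y by (auto simp: bij_betw_def)
    have fM: "finite (basis M)" and fN: "finite (basis N)" and kM: "Poly_Mapping.keys (coact M x) \<subseteq> basis M \<times> UNIV"
      and kN: "Poly_Mapping.keys (coact N y) \<subseteq> basis N \<times> UNIV"
      using M N x \<open>y \<in> comod_space N\<close> by (auto simp: is_comodule_def)
    have yx: "coact N y = tensor_map F id (coact M x)"
      using F x y by (simp add: comod_hom_def)
    have "Poly_Mapping.lookup (tensor_map G id (coact N y)) (b, r)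
        = Poly_Mapping.lookup (coact M x) (b, r)" for b r
    proof -
      have Gl: "Poly_Mapping.lookup (G u) b = (\<Sum>e\<in>basis N. Poly_Mapping.lookup u e
          * Poly_Mapping.lookup (G (bvec e)) b)" if "u \<in> comod_space N" for u
        using that fN
        by (subst linear_eq_lin_ext[OF G])
          (simp add: lookup_lin_ext_superset[of "basis N"] comod_space_def)
      \<comment> \<open>Together with \<open>Gl\<close> this makes the product of the matrices of
        \<open>F\<close> and \<open>G\<close> the identity on \<open>basis M\<close>.\<close>
      have FM: "F (bvec e) \<in> comod_space N \<and> G (F (bvec e)) = bvec e" if "e \<in> basis M" for e
        using that GF bij by (auto simp: bij_betw_def comod_space_def)
      have "Poly_Mapping.lookup (tensor_map G id (coact N y)) (b, r)
        = (\<Sum>e\<in>basis N. (\<Sum>e'\<in>basis M. Poly_Mapping.lookup (coact M x) (e', r) *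
             Poly_Mapping.lookup (F (bvec e')) e) * Poly_Mapping.lookup (G (bvec e)) b)"
        unfolding lookup_tensor_map_id_right[OF fN kN]
        unfolding yx lookup_tensor_map_id_right[OF fM kM] ..
      also have "\<dots> = (\<Sum>e'\<in>basis M. Poly_Mapping.lookup (coact M x) (e', r) *
             (\<Sum>e\<in>basis N. Poly_Mapping.lookup (F (bvec e')) e * Poly_Mapping.lookup (G (bvec e)) b))"
        unfolding sum_distrib_left sum_distrib_right by (subst sum.swap) (simp add: mult.assoc)
      also have "\<dots> = (\<Sum>e'\<in>basis M. if e' = b then Poly_Mapping.lookup (coact M x) (b, r) else 0)"
        using FM by (intro sum.cong refl) (simp add: Gl[symmetric] lookup_single when_def)
      also have "\<dots> = Poly_Mapping.lookup (coact M x) (b, r)"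
      proof -
        have "b \<in> basis M \<or> Poly_Mapping.lookup (coact M x) (b, r) = 0"
          using kM by (metis in_keys_iff mem_Sigma_iff subsetD)
        then show ?thesis using fM by auto
      qed
      finally show ?thesis .
    qed
    then show ?thesis
      using GF[OF x] y by (intro poly_mapping_eqI) (metis prod.exhaust)
  qed
  then have "comod_hom N M G"
    using G bij' by (auto simp: comod_hom_def bij_betw_def)
  with M N bij' show ?thesis unfolding comod_iso_def by blast
qed

lemma comod_space_eq_span:
  "finite (basis M) \<Longrightarrow> comod_space M = pm.span (bvec ` basis M)"
proof
  show "comod_space M \<subseteq> pm.span (bvec ` basis M)"
  proof
    fix x assume x: "x \<in> comod_space M"
    have "x = lin_ext bvec x"
      using fun_cong[OF linear_eq_lin_ext[OF pm.linear_id], of x] by (simp add: comp_def)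
    then have "x = (\<Sum>b\<in>Poly_Mapping.keys x. scale (Poly_Mapping.lookup x b) (bvec b))"
      by (simp add: lin_ext_def)
    also have "\<dots> \<in> pm.span (bvec ` basis M)"
      using x by (intro pm.span_sum pm.span_scale pm.span_base) (auto simp: comod_space_def)
    finally show "x \<in> pm.span (bvec ` basis M)" .
  qed
  show "pm.span (bvec ` basis M) \<subseteq> comod_space M"
    by (rule pm.span_minimal[OF _ subspace_comod_space]) (auto simp: comod_space_def)
qed

lemma inj_bvec: "inj_on (bvec :: 'b \<Rightarrow> 'b \<Rightarrow>\<^sub>0 'k::field) B"
  by (auto simp: inj_on_def dest!: arg_cong[where f = Poly_Mapping.keys])

lemma independent_bvec:
  assumes "finite B"
  shows "pm.independent (bvec ` B :: ('b \<Rightarrow>\<^sub>0 'k::field) set)"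
proof (rule pm.independent_if_scalars_zero)
  show "finite (bvec ` B :: ('b \<Rightarrow>\<^sub>0 'k) set)" using assms by simp
  fix f :: "('b \<Rightarrow>\<^sub>0 'k) \<Rightarrow> 'k" and x :: "'b \<Rightarrow>\<^sub>0 'k"
  assume 0: "(\<Sum>x\<in>bvec ` B. scale (f x) x) = 0" and "x \<in> bvec ` B"
  then obtain b where b: "b \<in> B" "x = bvec b" by blast
  have "0 = Poly_Mapping.lookup (\<Sum>x\<in>bvec ` B. scale (f x) x) b" by (simp add: 0)
  also have "\<dots> = (\<Sum>b'\<in>B. if b' = b then f x else 0)"
    unfolding lookup_sum sum.reindex[OF inj_bvec]
    by (intro sum.cong refl) (auto simp: b lookup_single when_def)
  finally show "f x = 0" using assms b by simp
qed

text \<open>The ambient function space may be infinite dimensional, so the count takes place inside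
  spans: a vector of \<open>comod_space N\<close> missed by the image would give one independent
  vector too many.\<close>

lemma inj_on_comod_space_imp_bij:
  fixes M :: "('b, 'k::field) comod" and N :: "('c, 'k) comod"
  assumes lin: "Vector_Spaces.linear scale scale F" and im: "F ` comod_space M \<subseteq> comod_space N"
    and inj: "inj_on F (comod_space M)"
    and fin: "finite (basis M)" "finite (basis N)" and card: "card (basis M) = card (basis N)"
  shows "bij_betw F (comod_space M) (comod_space N)"
proof -
  let ?A = "F ` bvec ` basis M"
  have M: "comod_space M = pm.span (bvec ` basis M)" and N: "comod_space N = pm.span (bvec ` basis N)"
    using fin by (simp_all add: comod_space_eq_span)
  have indep: "pm.independent ?A"
    using inj M pmp.linear_independent_injective_image[OF lin independent_bvec[OF fin(1)]] by simp
  have bvec_M: "bvec ` basis M \<subseteq> comod_space M"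
    by (simp add: M pm.span_superset)
  have "inj_on F (bvec ` basis M)"
    by (rule inj_on_subset[OF inj bvec_M])
  then have card_A: "card ?A = card (bvec ` basis N :: ('c \<Rightarrow>\<^sub>0 'k) set)"
    using card by (simp add: card_image inj_bvec)
  have A_sub: "?A \<subseteq> pm.span (bvec ` basis N)"
    using image_mono[OF bvec_M, of F] im unfolding N[symmetric] by (rule subset_trans)
  have "comod_space N \<subseteq> pm.span ?A"
  proof (rule subsetI, rule ccontr)
    fix y assume y: "y \<in> comod_space N" "y \<notin> pm.span ?A"
    then have "pm.independent (insert y ?A)" using pm.independent_insertI[OF _ indep] by simp
    moreover have "insert y ?A \<subseteq> pm.span (bvec ` basis N)" using y(1) A_sub N by simp
    ultimately have "card (insert y ?A) \<le> card (bvec ` basis N :: ('c \<Rightarrow>\<^sub>0 'k) set)"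
      using pm.independent_span_bound[of "bvec ` basis N" "insert y ?A"] fin by simp
    moreover have "y \<notin> ?A" using y(2) pm.span_base[of y ?A] by metis
    ultimately show False using fin card_A by simp
  qed
  then have "comod_space N \<subseteq> F ` comod_space M"
    by (simp add: M pmp.linear_span_image[OF lin])
  with im have "F ` comod_space M = comod_space N" by (rule equalityI)
  with inj show ?thesis by (rule bij_betw_imageI)
qed

section \<open>String comodules and direct sums\<close>

text \<open>Here \<open>X\<close> shifts each basis vector to the next and kills the last
  one.\<close>

lemma graded_comod_V:
  "graded_comod (V i l :: (nat, 'k::field) comod) (\<lambda>m. i + int m)
     (\<lambda>n b c. if c = b + n \<and> c \<le> l then 1 else 0)"
proof
  fix b c :: nat and i' n
  assume b: "b \<in> basis (V i l :: (nat, 'k) comod)"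
  have "Poly_Mapping.lookup (coact_basis (V i l :: (nat, 'k) comod) b) (c, (i', n))
    = (\<Sum>j = b..l. if j = c then if i' = i + int b \<and> c = b + n then 1 else 0 else 0)"
    unfolding V_def comod.simps lookup_sum
    by (intro sum.cong refl) (auto simp: lookup_single when_def)
  then show "Poly_Mapping.lookup (coact_basis (V i l :: (nat, 'k) comod) b) (c, (i', n))
    = (if i' = i + int b then if c = b + n \<and> c \<le> l then 1 else 0 else 0)"
    by auto
next
  fix b c n k :: nat
  assume "b \<in> basis (V i l :: (nat, 'k) comod)"
  have "(\<Sum>e\<in>basis (V i l :: (nat, 'k) comod).
      (if e = b + n \<and> e \<le> l then 1 else 0) * (if c = e + k \<and> c \<le> l then 1 else 0))
    = (\<Sum>e\<in>{0..l}. if e = b + n then if c = b + n + k \<and> c \<le> l then 1 else 0 else (0::'k))"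
    unfolding V_def by (intro sum.cong) auto
  then show "(if c = b + (n + k) \<and> c \<le> l then 1 else 0) = (\<Sum>e\<in>basis (V i l :: (nat, 'k) comod).
      (if e = b + n \<and> e \<le> l then 1 else 0) * (if c = e + k \<and> c \<le> l then 1 else (0::'k)))"
    by auto
qed (auto simp: V_def split: if_splits)

lemma graded_comod_dsum:
  assumes fin: "finite I" and M: "\<And>i. i \<in> I \<Longrightarrow> graded_comod (M i) (deg i) (C i)"
  shows "graded_comod (comod_dsum I M) (\<lambda>(i, b). deg i b)
    (\<lambda>n (i, b) (i', c). if i' = i then C i n b c else 0)"
proof (unfold_locales, goal_cases)
  case 1
  then show ?case
    using fin graded_comod.finite_basis[OF M] by (simp add: comod_dsum_def)
next
  case (2 b c i n)
  obtain j b' where b: "b = (j, b')" by force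
  obtain j' c' where c: "c = (j', c')" by force
  have j: "j \<in> I" "b' \<in> basis (M j)" using 2 by (auto simp: b comod_dsum_def)
  let ?x = "coact_basis (M j) b'"
  let ?K = "insert (c', (i, n)) (Poly_Mapping.keys ?x)"
  have "Poly_Mapping.lookup (coact_basis (comod_dsum I M) b) (c, (i, n))
    = (\<Sum>k\<in>?K. if k = (c', (i, n)) then if j' = j then Poly_Mapping.lookup ?x (c', (i, n)) else 0 else 0)"
    unfolding b c comod_dsum_def
    by (simp only: comod.simps prod.case, subst lookup_lin_ext_superset[of ?K], simp, blast,
        intro sum.cong refl) (auto simp: lookup_single when_def split: prod.splits if_splits)
  then show ?case
    by (simp add: b c graded_comod.lookup_coact_basis[OF M] j)
next
  case (3 b n c)
  then show ?case
    using graded_comod.C_in_basis[OF M] by (auto simp: comod_dsum_def split: if_splits prod.splits)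
next
  case (4 b n c)
  then show ?case
    using graded_comod.C_deg[OF M] by (auto simp: comod_dsum_def split: if_splits prod.splits)
next
  case (5 b c)
  then show ?case
    using graded_comod.C_0[OF M] by (auto simp: comod_dsum_def split: if_splits prod.splits)
next
  case (6 b n k c)
  obtain j b' where b: "b = (j, b')" by force
  obtain j' c' where c: "c = (j', c')" by force
  have j: "j \<in> I" "b' \<in> basis (M j)" using 6 by (auto simp: b comod_dsum_def)
  have "(\<Sum>e\<in>basis (comod_dsum I M). (case b of (i, b) \<Rightarrow> \<lambda>(i', c). if i' = i then C i n b c else 0) e *
      (case e of (i, b) \<Rightarrow> \<lambda>(i', c). if i' = i then C i k b c else 0) c)
    = (\<Sum>i\<in>I. \<Sum>e\<in>basis (M i). (if i = j then C j n b' e else 0) * (if j' = i then C i k e c' else 0))"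
    using fin graded_comod.finite_basis[OF M]
    by (simp add: b c comod_dsum_def sum.Sigma) (rule sum.cong, auto)
  also have "\<dots> = (\<Sum>i\<in>I. if i = j then if j' = j then 
      \<Sum>e\<in>basis (M j). C j n b' e * C j k e c' else 0 else 0)"
    by (intro sum.cong refl) auto
  also have "\<dots> = (if j' = j then C j (n + k) b' c' else 0)"
    using fin j by (simp add: graded_comod.C_add[OF M])
  finally show ?case by (simp add: b c)
qed

section \<open>Gaussian binomials and the operator of a tensor product\<close>

lemma qnum_Suc: "qnum q (Suc n) = 1 + q * qnum q n"
  unfolding qnum_def sum.lessThan_Suc_shift by (simp add: sum_distrib_left)

lemma qnum_Suc': "qnum q (Suc n) = qnum q n + q ^ n"
  by (simp add: qnum_def)

lemma qnum_0 [simp]: "qnum q 0 = 0"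
  by (simp add: qnum_def)

text \<open>The geometric sum is split after its first \<open>b\<close> terms. This is the source of
  the q-Pascal recursion.\<close>

lemma qnum_add: "qnum q (a + b) = q ^ b * qnum q a + qnum q b"
  by (induction a) (simp_all add: qnum_Suc' power_add algebra_simps)

lemma qfact_Suc: "qfact q (Suc n) = qfact q n * qnum q (Suc n)"
  by (simp add: qfact_def)

lemma qfact_0 [simp]: "qfact q 0 = 1"
  by (simp add: qfact_def)

lemma poly_qfact: "poly (qfact [:0, 1:] n) q = qfact q n"
  by (induction n) (simp_all add: qfact_Suc poly_sum qnum_def)

text \<open>At \<open>q = 0\<close> every \<open>qnum\<close> of positive index equals 1, so the
  polynomial takes the value 1 there.\<close>

lemma qfact_indet_nonzero: "qfact [:0, 1 :: 'k::field:] n \<noteq> 0"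
proof -
  have "qfact (0 :: 'k) n = 1" by (induction n) (simp_all add: qfact_Suc qnum_Suc)
  then show ?thesis by (metis poly_qfact poly_0 zero_neq_one)
qed

text \<open>The Gaussian binomial as a polynomial given by q-Pascal recursion, an explicit quotient
  for the exact division in \<open>qbinom\<close>.\<close>

fun gauss_poly :: "nat \<Rightarrow> nat \<Rightarrow> 'k::field poly" where
  "gauss_poly 0 m = 1"
| "gauss_poly (Suc l) 0 = 1"
| "gauss_poly (Suc l) (Suc m) =
     [:0, 1:] ^ Suc m * gauss_poly l (Suc m) + gauss_poly (Suc l) m"

lemma gauss_poly_right_0 [simp]: "gauss_poly l 0 = 1"
  by (cases l) auto

text \<open>Splitting the last factor of the factorial by \<open>qnum_add\<close> yields two
  summands, one for each induction hypothesis.\<close>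

lemma qfact_eq_gauss_poly:
  "qfact [:0, 1:] (l + m) = gauss_poly l m * (qfact [:0, 1:] l * qfact [:0, 1 :: 'k::field:] m)"
proof (induction l m rule: gauss_poly.induct)
  case (3 l m)
  let ?X = "[:0, 1 :: 'k:]"
  have "qfact ?X (Suc l + Suc m) = (?X ^ Suc m * qnum ?X (Suc l) + qnum ?X (Suc m)) * qfact ?X (Suc (l + m))"
    by (simp only: qnum_add[symmetric]) (simp add: qfact_Suc mult.commute)
  also have "\<dots> = ?X ^ Suc m * qnum ?X (Suc l) * qfact ?X (l + Suc m)
      + qnum ?X (Suc m) * qfact ?X (Suc l + m)"
    by (simp only: distrib_right add_Suc add_Suc_right)
  also have "\<dots> = gauss_poly (Suc l) (Suc m) * (qfact ?X (Suc l) * qfact ?X (Suc m))"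
    unfolding 3 gauss_poly.simps(3) qfact_Suc by (simp only: algebra_simps)
  finally show ?case .
qed auto

lemma qbinom_eq: "qbinom q l m = poly (gauss_poly l m) q"
  unfolding qbinom_def qfact_eq_gauss_poly by (simp add: qfact_indet_nonzero)

lemma qbinom_0_left [simp]: "qbinom q 0 m = 1"
  by (simp add: qbinom_eq)

lemma qbinom_0_right [simp]: "qbinom q l 0 = 1"
  by (simp add: qbinom_eq)

lemma qbinom_Suc_Suc:
  "qbinom q (Suc l) (Suc m) = q ^ Suc m * qbinom q l (Suc m) + qbinom q (Suc l) m"
  by (simp add: qbinom_eq)

text \<open>For \<open>q = 1\<close> the value is \<open>n\<close>, nonzero in characteristic 0;
  otherwise it is \<open>(q^n - 1) / (q - 1)\<close>.\<close>

lemma qnum_nonzero: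
  fixes q :: "'k::field_char_0"
  assumes "q = 1 \<or> \<not> (\<exists>n>0. q ^ n = 1)" "n > 0"
  shows "qnum q n \<noteq> 0"
proof (cases "q = 1")
  case True
  then show ?thesis using assms by (simp add: qnum_def)
next
  case False
  moreover from this have "q ^ n \<noteq> 1" using assms by blast
  ultimately show ?thesis
    using geometric_sum[of q n] by (simp add: qnum_def)
qed

text \<open>It is a factor of a q-factorial, and that is a product of nonzero q-numbers.\<close>

lemma qbinom_nonzero:
  fixes q :: "'k::field_char_0"
  assumes "q = 1 \<or> \<not> (\<exists>n>0. q ^ n = 1)"
  shows "qbinom q l m \<noteq> 0"
proof -
  have "qfact q (l + m) \<noteq> 0"
    using qnum_nonzero[OF assms] by (simp add: qfact_def)
  moreover have "qfact q (l + m) = qbinom q l m * (qfact q l * qfact q m)"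
    using arg_cong[OF qfact_eq_gauss_poly[of l m], of "\<lambda>p. poly p q"]
    by (simp add: poly_qfact qbinom_eq)
  ultimately show ?thesis by auto
qed

section \<open>Matrix of the coaction on a tensor product\<close>

text \<open>The entry is the coefficient in the product of the path of length \<open>a' - a\<close>
  at \<open>s + a\<close> with the path of length \<open>b' - b\<close> at \<open>t + b\<close>. The
  vertex \<open>t\<close> affects only the degree.\<close>

definition tensor_mat :: "'k::field \<Rightarrow> int \<Rightarrow> nat \<Rightarrow> nat \<Rightarrow> nat \<Rightarrow> nat \<times> nat \<Rightarrow> nat \<times> nat \<Rightarrow> 'k"
  where "tensor_mat q s l m n = (\<lambda>(a, b) (a', b').
    if a \<le> a' \<and> a' \<le> l \<and> b \<le> b' \<and> b' \<le> m \<and> n = (a' - a) + (b' - b)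
    then q powi ((s + int a) * int (b' - b)) * qbinom q (a' - a) (b' - b) else 0)"

lemma lookup_coact_basis_tensor:
  assumes "a \<le> l" "b \<le> m"
  shows "Poly_Mapping.lookup (coact_basis (comod_tensor q (V s l) (V t m)) (a, b)) ((a', b'), (i, n))
    = (if i = s + t + int a + int b then tensor_mat q s l m n (a, b) (a', b') else 0)"
proof -
  let ?c = "\<lambda>j k. q powi ((s + int a) * int (k - b)) * qbinom q (j - a) (k - b)"
  have coact: "coact_basis (comod_tensor q (V s l) (V t m)) (a, b)
    = (\<Sum>j=a..l. \<Sum>k=b..m. scale (?c j k)
         (bvec ((j, k), (s + int a + (t + int b), j - a + (k - b)))))"
    unfolding comod_tensor_def V_def comod.simps prod.case tensor_vec_sum_left
    unfolding tensor_vec_sum_right lin_ext_sum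
    by (simp add: kA_mult_def tensor_vec_scale_right add.commute)
  have "Poly_Mapping.lookup (coact_basis (comod_tensor q (V s l) (V t m)) (a, b)) ((a', b'), (i, n))
    = (\<Sum>j=a..l. \<Sum>k=b..m. if j = a' then if k = b' then
        if i = s + t + int a + int b \<and> n = a' - a + (b' - b) then ?c a' b' else 0 else 0 else 0)"
    unfolding coact lookup_sum by (intro sum.cong refl) (auto simp: lookup_single when_def)
  also have "\<dots> = (\<Sum>j=a..l. if j = a' then \<Sum>k=b..m. if k = b' then
        if i = s + t + int a + int b \<and> n = a' - a + (b' - b) then ?c a' b' else 0 else 0 else 0)"
    by (intro sum.cong refl) auto
  also have "\<dots> = (if i = s + t + int a + int b then tensor_mat q s l m n (a, b) (a', b') else 0)"
    by (auto simp: tensor_mat_def)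
  finally show ?thesis .
qed

text \<open>The first application of \<open>X\<close> is split off: it raises \<open>a\<close> with
  weight 1 or \<open>b\<close> with weight \<open>q powi (s + int a)\<close>. This is the q-Pascal
  rule.\<close>

lemma tensor_mat_Suc:
  assumes "q \<noteq> 0"
  shows "tensor_mat q s l m (Suc n) (a, b) c
    = tensor_mat q s l m n (Suc a, b) c + q powi (s + int a) * tensor_mat q s l m n (a, Suc b) c"
proof -
  obtain a' b' where c: "c = (a', b')" by force
  show ?thesis
  proof (cases "a \<le> a' \<and> a' \<le> l \<and> b \<le> b' \<and> b' \<le> m \<and> Suc n = (a' - a) + (b' - b)")
    case False
    have "\<not> (Suc a \<le> a' \<and> a' \<le> l \<and> b \<le> b' \<and> b' \<le> m \<and> n = (a' - Suc a) + (b' - b))"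
      using False by linarith
    moreover have "\<not> (a \<le> a' \<and> a' \<le> l \<and> Suc b \<le> b' \<and> b' \<le> m \<and> n = (a' - a) + (b' - Suc b))"
      using False by linarith
    ultimately show ?thesis
      using False unfolding c tensor_mat_def prod.case by (simp only: if_False) simp
  next
    case True
    then obtain A B where AB: "a' = a + A" "b' = b + B" "Suc n = A + B"
      using that[of "a' - a" "b' - b"] by simp
    have pw: "q powi (x + y) = q powi x * q powi y" for x y
      using assms by (simp add: power_int_add)
    show ?thesis
    proof (cases A; cases B)
      fix A' B' assume S: "A = Suc A'" "B = Suc B'"
      \<comment> \<open>Raising \<open>a\<close> first replaces the base exponent
        \<open>s + a\<close> by \<open>s + a + 1\<close>, which absorbs the power of
        \<open>q\<close> in \<open>qbinom_Suc_Suc\<close>.\<close>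
      have "q powi ((s + int a) * int B) * q ^ B = q powi ((s + int (Suc a)) * int B)"
        by (simp add: algebra_simps pw)
      moreover have "q powi ((s + int a) * int B) = q powi (s + int a) * q powi ((s + int a) * int B')"
        by (simp add: S algebra_simps pw)
      ultimately show ?thesis
        using True AB by (auto simp: c tensor_mat_def S qbinom_Suc_Suc algebra_simps)
    qed (use True AB in \<open>auto simp: c tensor_mat_def pw algebra_simps\<close>)
  qed
qed

text \<open>Once the matrices obey the one-step recursion they are powers of a single operator, so
  induction on \<open>n\<close> suffices.\<close>

lemma tensor_mat_add:
  assumes "q \<noteq> 0"
  shows "tensor_mat q s l m (n + k) (a, b) c
    = (\<Sum>e\<in>{0..l} \<times> {0..m}. tensor_mat q s l m n (a, b) e * tensor_mat q s l m k e c)"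
proof (induction n arbitrary: a b)
  case 0
  have "(\<Sum>e\<in>{0..l} \<times> {0..m}. tensor_mat q s l m 0 (a, b) e * tensor_mat q s l m k e c)
    = (\<Sum>e\<in>{0..l} \<times> {0..m}. if e = (a, b) then tensor_mat q s l m k (a, b) c else 0)"
    by (intro sum.cong refl) (auto simp: tensor_mat_def split: if_splits)
  also have "\<dots> = tensor_mat q s l m k (a, b) c"
    by (cases c) (auto simp: tensor_mat_def)
  finally show ?case by simp
next
  case (Suc n)
  then show ?case
    by (simp add: tensor_mat_Suc[OF assms] distrib_right sum.distrib sum_distrib_left mult.assoc)
qed

lemma graded_comod_tensor:
  assumes "q \<noteq> 0"
  shows "graded_comod (comod_tensor q (V s l) (V t m)) (\<lambda>(a, b). s + t + int a + int b)
    (tensor_mat q s l m)"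
proof -
  have B: "basis (comod_tensor q (V s l) (V t m)) = {0..l} \<times> {0..m}"
    by (simp add: comod_tensor_def V_def)
  show ?thesis
  proof (unfold_locales, unfold B, goal_cases)
    case (2 b c i n)
    then show ?case by (cases b; cases c) (simp add: lookup_coact_basis_tensor)
  next
    case (6 b n k c)
    then show ?case by (cases b) (simp add: tensor_mat_add[OF assms])
  qed (auto simp: tensor_mat_def split: if_splits)
qed

section \<open>Decomposition into strings\<close>

context graded_comod
begin

text \<open>Coefficients are plain functions, so that explicit formulas on index pairs can be
  iterated; values of \<open>y\<close> outside the basis are dropped.\<close>

definition act :: "nat \<Rightarrow> ('b \<Rightarrow> 'k) \<Rightarrow> 'b \<Rightarrow> 'k"
  where "act n y c = (\<Sum>b\<in>basis M. y b * C n b c)"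

lemma act_act: "act k (act n y) = act (n + k) y"
proof
  fix c
  show "act k (act n y) c = act (n + k) y c"
    unfolding act_def sum_distrib_right
    by (subst sum.swap) (simp add: C_add sum_distrib_left mult.assoc)
qed

lemma act_zero [simp]: "act n (\<lambda>_. 0) = (\<lambda>_. 0)"
  by (simp add: act_def fun_eq_iff)

lemma act_0:
  assumes "\<And>b. y b \<noteq> 0 \<Longrightarrow> b \<in> basis M"
  shows "act 0 y = y"
proof
  fix c
  have "act 0 y c = (\<Sum>b\<in>basis M. if b = c then y c else 0)"
    unfolding act_def by (intro sum.cong refl) (auto simp: C_0)
  then show "act 0 y c = y c" using finite_basis assms by auto
qed

lemma act_nonzero:
  assumes "act n y c \<noteq> 0"
  obtains b where "b \<in> basis M" "y b \<noteq> 0" "c \<in> basis M" "deg c = deg b + int n"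
proof -
  obtain b where "b \<in> basis M" "y b * C n b c \<noteq> 0"
    using assms unfolding act_def by (rule sum.not_neutral_contains_not_neutral)
  then show ?thesis using that C_in_basis C_deg by (metis mult_eq_0_iff)
qed

text \<open>String \<open>i\<close> ends in degree \<open>d + N - i\<close>, so the nonzero ends lie
  in distinct degrees and the strings are independent; the equality of dimensions then gives
  surjectivity.\<close>

lemma dsum_strings_iso:
  fixes w :: "nat \<Rightarrow> 'b \<Rightarrow> 'k"
  assumes pN: "2 * p \<le> N"
    and w_deg: "\<And>i c. i \<le> p \<Longrightarrow> w i c \<noteq> 0 \<Longrightarrow> deg c = d + int i"
    and w_top: "\<And>i. i \<le> p \<Longrightarrow> act (N - 2 * i) (w i) \<noteq> (\<lambda>_. 0)"
    and w_end: "\<And>i. i \<le> p \<Longrightarrow> act (Suc (N - 2 * i)) (w i) = (\<lambda>_. 0)"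
    and card: "card (basis M) = (\<Sum>i\<le>p. Suc (N - 2 * i))"
  shows "comod_dsum {0..p} (\<lambda>i. V (d + int i) (N - 2 * i)) \<cong>\<^sub>c M"
proof -
  let ?D = "comod_dsum {0..p} (\<lambda>i. V (d + int i) (N - 2 * i)) :: (nat \<times> nat, 'k) comod"
  have D_basis: "basis ?D = (SIGMA i:{0..p}. {0..N - 2 * i})"
    by (simp add: comod_dsum_def V_def)
  \<comment> \<open>The basis vector \<open>j\<close> of summand \<open>i\<close> goes to
    \<open>X^j w_i\<close>.\<close>
  define f where "f = (\<lambda>(i, j). \<Sum>c\<in>basis M. Poly_Mapping.single c (act j (w i) c))"
  have f: "Poly_Mapping.lookup (f (i, j)) c = act j (w i) c" for i j c
  proof -
    have "Poly_Mapping.lookup (f (i, j)) c = (\<Sum>b\<in>basis M. if b = c then act j (w i) c else 0)"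
      unfolding f_def prod.case lookup_sum by (intro sum.cong refl) (auto simp: lookup_single when_def)
    then show ?thesis using finite_basis by (auto elim: act_nonzero)
  qed
  have act_late: "act n (w i) = (\<lambda>_. 0)" if "i \<le> p" "N - 2 * i < n" for i n
    using act_act[of "n - Suc (N - 2 * i)" "Suc (N - 2 * i)" "w i"] w_end that by simp
  interpret D: graded_comod ?D "\<lambda>(i, b). d + int i + int b"
    "\<lambda>n (i, b) (i', c). if i' = i then if c = b + n \<and> c \<le> N - 2 * i then 1 else 0 else 0"
    by (rule graded_comod_dsum) (auto intro: graded_comod_V)
  have hom: "comod_hom ?D M (lin_ext f)"
  proof (rule comod_hom_lin_ext[OF D.graded_comod_axioms graded_comod_axioms])
    fix b assume "b \<in> basis ?D"
    then obtain i j where b: "b = (i, j)" "i \<le> p" "j \<le> N - 2 * i"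
      by (auto simp: D_basis)
    show "Poly_Mapping.keys (f b) \<subseteq> basis M"
      by (auto simp: b in_keys_iff f elim: act_nonzero)
    show "deg c = (case b of (i, b) \<Rightarrow> d + int i + int b)" if "c \<in> Poly_Mapping.keys (f b)" for c
      using that w_deg[OF b(2)] by (auto simp: b in_keys_iff f elim!: act_nonzero)
    fix c n
    have "(\<Sum>e\<in>basis ?D. (case b of (i, b) \<Rightarrow> \<lambda>(i', c).
        if i' = i then if c = b + n \<and> c \<le> N - 2 * i then 1 else 0 else 0) e *
        Poly_Mapping.lookup (f e) c)
      = (\<Sum>e\<in>basis ?D. if e = (i, j + n) then act (j + n) (w i) c else 0)"
      by (intro sum.cong refl) (auto simp: b f D_basis split: prod.splits)
    \<comment> \<open>If \<open>j + n\<close> passes the end of the string, no index matches on the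
      left and the right side vanishes by \<open>act_late\<close>.\<close>
    also have "\<dots> = act (j + n) (w i) c"
      using D.finite_basis b act_late[of i "j + n"] by (auto simp: D_basis not_le)
    also have "\<dots> = (\<Sum>e\<in>basis M. Poly_Mapping.lookup (f b) e * C n e c)"
      unfolding act_act[symmetric] by (simp add: b f act_def[of n])
    finally show "(\<Sum>e\<in>basis ?D. (case b of (i, b) \<Rightarrow> \<lambda>(i', c).
        if i' = i then if c = b + n \<and> c \<le> N - 2 * i then 1 else 0 else 0) e *
        Poly_Mapping.lookup (f e) c) = (\<Sum>e\<in>basis M. Poly_Mapping.lookup (f b) e * C n e c)" .
  qed
  \<comment> \<open>The strings \<open>X\<^sup>j w\<^sub>i\<close> are independent: in a relation of fixed degree, apply the power of \<open>X\<close>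
    that moves the longest occurring string to its end; it annihilates all shorter ones.\<close>
  have "x = 0" if x: "x \<in> comod_space ?D" and Fx: "lin_ext f x = 0" for x
  proof (rule ccontr)
    let ?x = "Poly_Mapping.lookup x" and ?K = "Poly_Mapping.keys x"
    assume "x \<noteq> 0"
    then have K: "?K \<noteq> {}" by simp
    define i0 where "i0 = Min (fst ` ?K)"
    have "i0 \<in> fst ` ?K" unfolding i0_def using K by (intro Min_in) auto
    then obtain j0 where j0: "(i0, j0) \<in> ?K" by auto
    have i0_le: "i0 \<le> i" if "(i, j) \<in> ?K" for i j
      unfolding i0_def using that by (intro Min_le) force+
    have K_sub: "i \<le> p \<and> j \<le> N - 2 * i" if "(i, j) \<in> ?K" for i j
      using that x by (auto simp: comod_space_def D_basis)
    define r where "r = N - 2 * i0 - j0"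
    obtain c where c: "act (N - 2 * i0) (w i0) c \<noteq> 0"
      using w_top[of i0] K_sub[OF j0] by (auto simp: fun_eq_iff)
    have deg_c: "deg c = d + int i0 + int (N - 2 * i0)"
      using c w_deg[of i0] K_sub[OF j0] by (auto elim!: act_nonzero)
    have "0 = act r (Poly_Mapping.lookup (lin_ext f x)) c" by (simp add: Fx act_def)
    also have "\<dots> = (\<Sum>b\<in>basis M. (\<Sum>(i, j)\<in>?K. ?x (i, j) * act j (w i) b) * C r b c)"
      unfolding act_def[of r]
      by (intro sum.cong refl) (simp add: lookup_lin_ext_superset[OF finite_keys subset_refl]
          case_prod_unfold f[symmetric])
    also have "\<dots> = (\<Sum>b\<in>basis M. \<Sum>k\<in>?K. ?x k * act (snd k) (w (fst k)) b * C r b c)"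
      by (simp add: sum_distrib_right case_prod_unfold)
    also have "\<dots> = (\<Sum>k\<in>?K. ?x k * act r (act (snd k) (w (fst k))) c)"
      by (subst sum.swap) (simp add: act_def[of r] sum_distrib_left mult.assoc)
    also have "\<dots> = (\<Sum>k\<in>?K. if k = (i0, j0) then ?x (i0, j0) * act (N - 2 * i0) (w i0) c else 0)"
    proof (intro sum.cong refl)
      fix k assume k: "k \<in> ?K"
      obtain i j where ij: "k = (i, j)" by force
      have ip: "i \<le> p" "j \<le> N - 2 * i" "i0 \<le> i" "i0 \<le> p" "j0 \<le> N - 2 * i0"
        using k K_sub i0_le j0 by (auto simp: ij)
      \<comment> \<open>The degree of \<open>c\<close> forces \<open>j - j0 = i0 - i\<close>.
        Inserting this into \<open>j + r <= N - 2 * i\<close> gives \<open>i <= i0\<close>, while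
        \<open>i0\<close> is minimal.\<close>
      have only: "k = (i0, j0)" if nz: "act (j + r) (w i) c \<noteq> 0"
      proof -
        have "deg c = d + int i + int (j + r)"
          using nz w_deg[OF ip(1)] by (auto elim!: act_nonzero)
        then have 1: "i + j = i0 + j0" using deg_c ip pN by (simp add: r_def of_nat_diff)
        have "j + r \<le> N - 2 * i" using nz act_late[OF ip(1), of "j + r"] by (cases "j + r \<le> N - 2 * i") auto
        then show ?thesis using 1 ip pN by (auto simp: r_def ij)
      qed
      have r: "j0 + r = N - 2 * i0" using ip by (simp add: r_def)
      show "?x k * act r (act (snd k) (w (fst k))) c
        = (if k = (i0, j0) then ?x (i0, j0) * act (N - 2 * i0) (w i0) c else 0)"
      proof (cases "k = (i0, j0)")
        case True
        then show ?thesis by (simp add: act_act r)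
      next
        case False
        then have "act (j + r) (w i) c = 0" using only by blast
        with False show ?thesis by (auto simp: ij act_act)
      qed
    qed
    also have "\<dots> = ?x (i0, j0) * act (N - 2 * i0) (w i0) c" using j0 by simp
    finally show False using c j0 by (simp add: in_keys_iff)
  qed
  then have "inj_on (lin_ext f) (comod_space ?D)"
    using pmp.linear_inj_on_iff_eq_0[OF lin_ext_linear subspace_comod_space] by blast
  moreover have "card (basis ?D) = card (basis M)"
    unfolding D_basis card by (simp add: atLeast0AtMost)
  ultimately have "bij_betw (lin_ext f) (comod_space ?D) (comod_space M)"
    using hom D.finite_basis finite_basis
    by (intro inj_on_comod_space_imp_bij) (auto simp: comod_hom_def)
  then show ?thesis
    using D.is_comodule is_comodule hom unfolding comod_iso_def by blast
qed

end

section \<open>The one-step operator and the lift between tensor products\<close>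

text \<open>The operator \<open>X\<close> on coefficient functions of \<open>V(s,l) \<otimes> V(t,m)\<close>, with \<open>z = q\<^sup>s\<close>.\<close>

definition tensor_step :: "'k::field \<Rightarrow> 'k \<Rightarrow> nat \<Rightarrow> nat \<Rightarrow> (nat \<times> nat \<Rightarrow> 'k) \<Rightarrow> nat \<times> nat \<Rightarrow> 'k"
  where "tensor_step q z l m y = (\<lambda>(a, b). if a \<le> l \<and> b \<le> m then
    (if a = 0 then 0 else y (a - 1, b)) + (if b = 0 then 0 else z * q ^ a * y (a, b - 1)) else 0)"

text \<open>
  The coefficients are \<open>q\<close>-analogues of those of multiplication by \<open>x\<^sub>1 y\<^sub>2 - x\<^sub>2 y\<^sub>1\<close>, which embeds
  \<open>V\<^sub>l \<otimes> V\<^sub>m\<close> into \<open>V\<^sub>l\<^sub>+\<^sub>1 \<otimes> V\<^sub>m\<^sub>+\<^sub>1\<close> when \<open>q = 1\<close> and the \<open>V\<close>s are realised as binary forms.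
\<close>

definition tensor_lift :: "'k::field \<Rightarrow> 'k \<Rightarrow> nat \<Rightarrow> nat \<Rightarrow> (nat \<times> nat \<Rightarrow> 'k) \<Rightarrow> nat \<times> nat \<Rightarrow> 'k"
  where "tensor_lift q z l m y = (\<lambda>(a, b). if a \<le> Suc l \<and> b \<le> Suc m then
    (if a = 0 then 0 else q ^ b * qnum q (Suc m - b) * y (a - 1, b))
    - (if b = 0 then 0 else z * q ^ (Suc m + a) * qnum q (Suc l - a) * y (a, b - 1)) else 0)"

text \<open>At \<open>(a, b)\<close> both sides are combinations of \<open>y\<close> at
  \<open>(a-2, b)\<close>, \<open>(a-1, b-1)\<close> and \<open>(a, b-2)\<close>. The outer
  coefficients agree directly; only the middle one needs a cancellation.\<close>

lemma tensor_step_lift: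
  "tensor_step q z (Suc l) (Suc m) (tensor_lift q z l m y)
    = tensor_lift q z l m (tensor_step q z l m y)"
proof
  fix c :: "nat \<times> nat"
  obtain a b where c: "c = (a, b)" by force
  have step_outside: "tensor_step q z l' m' u (a, b) = 0" if "\<not> (a \<le> l' \<and> b \<le> m')" for l' m' u
    using that by (auto simp: tensor_step_def)
  have lift_outside: "tensor_lift q z l m u (a, b) = 0" if "\<not> (a \<le> Suc l \<and> b \<le> Suc m)" for u
    using that by (auto simp: tensor_lift_def)
  show "tensor_step q z (Suc l) (Suc m) (tensor_lift q z l m y) c
    = tensor_lift q z l m (tensor_step q z l m y) c"
  proof (cases "a \<le> Suc l \<and> b \<le> Suc m")
    case False
    then show ?thesis by (simp add: c step_outside lift_outside)
  next
    case True
    show ?thesis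
    proof (cases a; cases b)
      fix a' b' assume ab: "a = Suc a'" "b = Suc b'"
      obtain A B where l: "l = a' + A" and m: "m = b' + B"
        using True that[of "l - a'" "m - b'"] by (simp add: ab)
      let ?pa = "if a' = 0 then 0 else y (a' - 1, Suc b')"
      let ?pb = "if b' = 0 then 0 else y (Suc a', b' - 1)"
      have diff: "Suc (a' + A) - a' = Suc A" "Suc (b' + B) - b' = Suc B" by auto
      \<comment> \<open>For \<open>B = 0\<close> the point lies outside the range and the formula
        for \<open>tensor_step\<close> fails, but the factor \<open>qnum q 0 = 0\<close> makes both
        sides vanish. The same holds for \<open>A\<close> below.\<close>
      have "qnum q B * tensor_step q z l m y (a', Suc b') = qnum q B * (?pa + z * q ^ a' * y (a', b'))"
        by (cases B) (auto simp: tensor_step_def l m)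
      moreover have "qnum q A * tensor_step q z l m y (Suc a', b')
          = qnum q A * (y (a', b') + z * q ^ Suc a' * ?pb)"
        by (cases A) (auto simp: tensor_step_def l m)
      moreover have "tensor_lift q z l m (tensor_step q z l m y) c
        = q ^ Suc b' * (qnum q B * tensor_step q z l m y (a', Suc b'))
          - z * q ^ (Suc m + Suc a') * (qnum q A * tensor_step q z l m y (Suc a', b'))"
        by (simp add: c ab tensor_lift_def l m mult.assoc)
      moreover have "tensor_step q z (Suc l) (Suc m) (tensor_lift q z l m y) c
        = tensor_lift q z l m y (a', Suc b') + z * q ^ Suc a' * tensor_lift q z l m y (Suc a', b')"
        by (simp add: c ab tensor_step_def l m)
      moreover have "tensor_lift q z l m y (a', Suc b')
        = q ^ Suc b' * qnum q B * ?pa - z * q ^ (Suc m + a') * (1 + q * qnum q A) * y (a', b')"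
        by (simp add: tensor_lift_def l m diff qnum_Suc)
      moreover have "tensor_lift q z l m y (Suc a', b')
        = q ^ b' * (qnum q B + q ^ B) * y (a', b') - z * q ^ (Suc m + Suc a') * qnum q A * ?pb"
        by (simp add: tensor_lift_def l m diff qnum_Suc')
      \<comment> \<open>In the coefficient of \<open>y (a', b')\<close> the summand 1 beside
        \<open>q * qnum q A\<close> cancels against \<open>q ^ B\<close>, because
        \<open>m = b' + B\<close>.\<close>
      ultimately show ?thesis
        by (simp only: m) (simp add: algebra_simps power_add)
    next
      fix b' assume ab: "a = 0" "b = Suc b'"
      show ?thesis using True by (auto simp: c ab tensor_step_def tensor_lift_def)
    next
      fix a' assume ab: "a = Suc a'" "b = 0"
      show ?thesis using True by (auto simp: c ab tensor_step_def tensor_lift_def)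
    qed (auto simp: c tensor_step_def tensor_lift_def)
  qed
qed

lemma tensor_step_lift_funpow:
  "(tensor_step q z (Suc l) (Suc m) ^^ n) (tensor_lift q z l m y)
    = tensor_lift q z l m ((tensor_step q z l m ^^ n) y)"
  by (induction n) (simp_all add: tensor_step_lift)

text \<open>A leading term argument: for the largest \<open>a\<close> in the support, only
  \<open>y (a, b)\<close> contributes at \<open>(Suc a, b)\<close>, with the nonzero factor
  \<open>q ^ b * qnum q (Suc m - b)\<close>.\<close>

lemma tensor_lift_nonzero:
  fixes q :: "'k::field"
  assumes q: "q \<noteq> 0" "\<And>n. n > 0 \<Longrightarrow> qnum q n \<noteq> 0"
    and supp: "\<And>a b. y (a, b) \<noteq> 0 \<Longrightarrow> a \<le> l \<and> b \<le> m"
    and nz: "y \<noteq> (\<lambda>_. 0)"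
  shows "tensor_lift q z l m y \<noteq> (\<lambda>_. 0)"
proof -
  define S where "S = {a. \<exists>b. y (a, b) \<noteq> 0}"
  have fin: "finite S" using supp by (intro finite_subset[of S "{0..l}"]) (auto simp: S_def)
  have "S \<noteq> {}" using nz by (auto simp: S_def fun_eq_iff)
  then have "Max S \<in> S" using fin by (rule Max_in[rotated])
  then obtain b where b: "y (Max S, b) \<noteq> 0" by (auto simp: S_def)
  have "y (Suc (Max S), b') = 0" for b'
  proof (rule ccontr)
    assume "y (Suc (Max S), b') \<noteq> 0"
    then have "Suc (Max S) \<in> S" by (auto simp: S_def)
    then show False using Max_ge[OF fin] by fastforce
  qed
  then have "tensor_lift q z l m y (Suc (Max S), b) = q ^ b * qnum q (Suc m - b) * y (Max S, b)"
    using supp[OF b] by (simp add: tensor_lift_def)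
  also have "\<dots> \<noteq> 0" using q b supp[OF b] by simp
  finally show ?thesis by (auto simp: fun_eq_iff)
qed

lemma tensor_step_supp:
  "tensor_step q z l m y (a, b) \<noteq> 0 \<Longrightarrow> a \<le> l \<and> b \<le> m"
  by (auto simp: tensor_step_def split: if_splits)

lemma tensor_step_funpow_supp:
  assumes "\<And>a b. y (a, b) \<noteq> 0 \<Longrightarrow> a \<le> l \<and> b \<le> m"
    and "(tensor_step q z l m ^^ n) y (a, b) \<noteq> 0"
  shows "a \<le> l \<and> b \<le> m"
  using assms by (cases n) (auto dest: tensor_step_supp)

lemma tensor_mat_0:
  "tensor_mat q s l m 0 (a, b) (a', b') = (if a' = a \<and> b' = b \<and> a \<le> l \<and> b \<le> m then 1 else 0)"
  by (auto simp: tensor_mat_def)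

text \<open>Both sides iterate the same one-step operator. The support hypothesis settles
  \<open>n = 0\<close>, where \<open>act\<close> truncates to the basis.\<close>

lemma tensor_act_eq:
  fixes q :: "'k::field"
  assumes q: "q \<noteq> 0" and supp: "\<And>a b. y (a, b) \<noteq> 0 \<Longrightarrow> a \<le> l \<and> b \<le> m"
  shows "graded_comod.act (comod_tensor q (V s l) (V t m)) (tensor_mat q s l m) n y
    = (tensor_step q (q powi s) l m ^^ n) y"
proof -
  interpret T: graded_comod "comod_tensor q (V s l) (V t m)" "\<lambda>(a, b). s + t + int a + int b"
    "tensor_mat q s l m"
    by (rule graded_comod_tensor[OF q])
  have B: "basis (comod_tensor q (V s l) (V t m)) = {0..l} \<times> {0..m}"
    by (simp add: comod_tensor_def V_def)
  have pw: "q powi (s + int a) = q powi s * q ^ a" for a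
    using q by (simp add: power_int_add)
  have step: "T.act 1 u = tensor_step q (q powi s) l m u"
    if u: "\<And>a b. u (a, b) \<noteq> 0 \<Longrightarrow> a \<le> l \<and> b \<le> m" for u
  proof
    fix c :: "nat \<times> nat"
    obtain a' b' where c: "c = (a', b')" by force
    have "T.act 1 u c = (\<Sum>e\<in>{0..l} \<times> {0..m}.
       (if e = (a' - 1, b') then if a' = 0 \<or> \<not> (a' \<le> l \<and> b' \<le> m) then 0 else u (a' - 1, b') else 0)
       + (if e = (a', b' - 1) then if b' = 0 \<or> \<not> (a' \<le> l \<and> b' \<le> m) then 0
          else q powi s * q ^ a' * u (a', b' - 1) else 0))"
      unfolding T.act_def B
    proof (intro sum.cong refl, clarify)
      fix a b
      show "u (a, b) * tensor_mat q s l m 1 (a, b) c =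
       (if (a, b) = (a' - 1, b') then if a' = 0 \<or> \<not> (a' \<le> l \<and> b' \<le> m) then 0 else u (a' - 1, b') else 0)
       + (if (a, b) = (a', b' - 1) then if b' = 0 \<or> \<not> (a' \<le> l \<and> b' \<le> m) then 0
          else q powi s * q ^ a' * u (a', b' - 1) else 0)"
        unfolding One_nat_def tensor_mat_Suc[OF q] tensor_mat_0 c pw
        by (cases a'; cases b') auto
    qed
    also have "\<dots> = tensor_step q (q powi s) l m u c"
      unfolding sum.distrib
      by (auto simp: c tensor_step_def sum.delta)
    finally show "T.act 1 u c = tensor_step q (q powi s) l m u c" .
  qed
  show "T.act n y = (tensor_step q (q powi s) l m ^^ n) y"
  proof (induction n)
    case 0
    show ?case using supp by (subst T.act_0) (auto simp: B)
  next
    case (Suc n)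
    have "T.act (Suc n) y = T.act 1 (T.act n y)" by (simp add: T.act_act)
    also have "\<dots> = tensor_step q (q powi s) l m (T.act n y)"
      using tensor_step_funpow_supp[OF supp] by (intro step) (simp add: Suc)
    finally show ?case by (simp add: Suc)
  qed
qed

text \<open>Induction on \<open>i\<close> with \<open>l\<close> and \<open>m\<close> varying: start
  from the product of the first basis vectors, then lift the string found for \<open>l - 1\<close>
  and \<open>m - 1\<close>. The exponent stays the same, as
  \<open>(l-1) + (m-1) - 2i = l + m - 2(i+1)\<close>.\<close>

lemma exists_string:
  fixes q :: "'k::field_char_0"
  assumes q: "q \<noteq> 0" "q = 1 \<or> \<not> (\<exists>n>0. q ^ n = 1)"
    and "i \<le> l" "i \<le> m"
  shows "\<exists>w. (\<forall>a b. w (a, b) \<noteq> 0 \<longrightarrow> a \<le> l \<and> b \<le> m \<and> a + b = i) \<and>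
    (tensor_step q (q powi s) l m ^^ (l + m - 2 * i)) w \<noteq> (\<lambda>_. 0) \<and>
    (tensor_step q (q powi s) l m ^^ Suc (l + m - 2 * i)) w = (\<lambda>_. 0)"
  using \<open>i \<le> l\<close> \<open>i \<le> m\<close>
proof (induction i arbitrary: l m)
  case 0
  \<comment> \<open>The choice \<open>t = 0\<close> is arbitrary, since \<open>tensor_step\<close>
    does not depend on \<open>t\<close>.\<close>
  interpret T: graded_comod "comod_tensor q (V s l) (V 0 m)" "\<lambda>(a, b). s + 0 + int a + int b"
    "tensor_mat q s l m"
    by (rule graded_comod_tensor[OF q(1)])
  have B: "basis (comod_tensor q (V s l) (V 0 m)) = {0..l} \<times> {0..m}"
    by (simp add: comod_tensor_def V_def)
  let ?w = "\<lambda>e. if e = (0, 0) then 1 else 0 :: 'k"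
  have act: "(tensor_step q (q powi s) l m ^^ n) ?w c = tensor_mat q s l m n (0, 0) c" for n c
  proof -
    have "(tensor_step q (q powi s) l m ^^ n) ?w = T.act n ?w"
      by (rule tensor_act_eq[OF q(1), symmetric]) (auto split: if_splits)
    then have "(tensor_step q (q powi s) l m ^^ n) ?w c = T.act n ?w c" by simp
    also have "\<dots> = (\<Sum>e\<in>{0..l} \<times> {0..m}. if e = (0, 0) then tensor_mat q s l m n (0, 0) c else 0)"
      unfolding T.act_def B by (intro sum.cong refl) auto
    finally show ?thesis by simp
  qed
  \<comment> \<open>The entry at the far corner is \<open>q powi (s * int m)\<close> times
    \<open>qbinom q l m\<close>.\<close>
  have "(tensor_step q (q powi s) l m ^^ (l + m)) ?w (l, m) \<noteq> 0"
    unfolding act using q qbinom_nonzero[OF q(2)] by (simp add: tensor_mat_def)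
  moreover have "(tensor_step q (q powi s) l m ^^ Suc (l + m)) ?w = (\<lambda>_. 0)"
    unfolding fun_eq_iff act by (auto simp: tensor_mat_def)
  ultimately show ?case by (intro exI[of _ ?w]) (auto simp: fun_eq_iff split: if_splits)
next
  case (Suc i)
  then obtain l' m' where lm: "l = Suc l'" "m = Suc m'" "i \<le> l'" "i \<le> m'"
    by (metis Suc_le_D Suc_le_mono)
  let ?z = "q powi s" and ?n = "l' + m' - 2 * i"
  obtain w where w: "\<And>a b. w (a, b) \<noteq> 0 \<Longrightarrow> a \<le> l' \<and> b \<le> m' \<and> a + b = i"
    and top: "(tensor_step q ?z l' m' ^^ ?n) w \<noteq> (\<lambda>_. 0)"
    and zero: "(tensor_step q ?z l' m' ^^ Suc ?n) w = (\<lambda>_. 0)"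
    using Suc.IH[OF lm(3,4)] by blast
  have n: "l + m - 2 * Suc i = ?n" by (simp add: lm)
  let ?w = "tensor_lift q ?z l' m' w"
  have "a \<le> l \<and> b \<le> m \<and> a + b = Suc i" if "?w (a, b) \<noteq> 0" for a b
  proof -
    have "a \<le> l \<and> b \<le> m \<and> (a \<noteq> 0 \<and> w (a - 1, b) \<noteq> 0 \<or> b \<noteq> 0 \<and> w (a, b - 1) \<noteq> 0)"
      using that by (auto simp: tensor_lift_def lm split: if_splits)
    then show ?thesis using w by fastforce
  qed
  \<comment> \<open>The top of the lifted string is the lift of the top of the shorter one, and the
    lift is injective on supported functions.\<close>
  moreover have "(tensor_step q ?z l m ^^ ?n) ?w \<noteq> (\<lambda>_. 0)"
    unfolding lm tensor_step_lift_funpow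
    using tensor_step_funpow_supp[of w l' m'] w top
    by (intro tensor_lift_nonzero q(1) qnum_nonzero[OF q(2)]) blast+
  moreover have "(tensor_step q ?z l m ^^ Suc ?n) ?w = (\<lambda>_. 0)"
    unfolding lm tensor_step_lift_funpow zero by (simp add: tensor_lift_def fun_eq_iff)
  ultimately show ?case unfolding n by blast
qed

section \<open>Dimension count and assembly\<close>

text \<open>For \<open>N = l + m\<close> and \<open>p = min l m\<close> the right side is
  \<open>(l+1)(m+1)\<close>, the dimension of the tensor product.\<close>

lemma sum_string_lengths:
  "2 * p \<le> N \<Longrightarrow> (\<Sum>i\<le>p. Suc (N - 2 * i)) = Suc p * Suc (N - p)"
proof (induction p)
  case (Suc p)
  then obtain r where "N = 2 * Suc p + r" by (auto simp: le_iff_add)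
  then show ?case using Suc by (simp add: algebra_simps)
qed simp

text \<open>The strings of \<open>exists_string\<close> satisfy the criterion
  \<open>dsum_strings_iso\<close> with \<open>d = s + t\<close>: a vector supported on
  \<open>a + b = i\<close> has degree \<open>s + t + i\<close>.\<close>

lemma dsum_iso_tensor:
  fixes q :: "'k::field_char_0"
  assumes q: "q \<noteq> 0" "q = 1 \<or> \<not> (\<exists>n>0. q ^ n = 1)"
  shows "comod_dsum {0..min l m} (\<lambda>i. V (s + t + int i) (l + m - 2 * i))
    \<cong>\<^sub>c comod_tensor q (V s l) (V t m)"
proof -
  let ?step = "tensor_step q (q powi s) l m"
  interpret T: graded_comod "comod_tensor q (V s l) (V t m)" "\<lambda>(a, b). s + t + int a + int b"
    "tensor_mat q s l m"
    by (rule graded_comod_tensor[OF q(1)])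
  have B: "basis (comod_tensor q (V s l) (V t m)) = {0..l} \<times> {0..m}"
    by (simp add: comod_tensor_def V_def)
  have "\<forall>i\<in>{..min l m}. \<exists>w. (\<forall>a b. w (a, b) \<noteq> 0 \<longrightarrow> a \<le> l \<and> b \<le> m \<and> a + b = i) \<and>
    (?step ^^ (l + m - 2 * i)) w \<noteq> (\<lambda>_. 0) \<and> (?step ^^ Suc (l + m - 2 * i)) w = (\<lambda>_. 0)"
    using exists_string[OF q] by simp
  then obtain w where w: "\<And>i a b. i \<le> min l m \<Longrightarrow> w i (a, b) \<noteq> 0 \<Longrightarrow> a \<le> l \<and> b \<le> m \<and> a + b = i"
    and top: "\<And>i. i \<le> min l m \<Longrightarrow> (?step ^^ (l + m - 2 * i)) (w i) \<noteq> (\<lambda>_. 0)"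
    and zero: "\<And>i. i \<le> min l m \<Longrightarrow> (?step ^^ Suc (l + m - 2 * i)) (w i) = (\<lambda>_. 0)"
    unfolding bchoice_iff by (metis atMost_iff)
  have act: "T.act n (w i) = (?step ^^ n) (w i)" if "i \<le> min l m" for i n
    using w[OF that] by (intro tensor_act_eq[OF q(1)]) blast
  show ?thesis
  proof (rule T.dsum_strings_iso)
    show "2 * min l m \<le> l + m" by simp
    show "(case c of (a, b) \<Rightarrow> s + t + int a + int b) = s + t + int i"
      if "i \<le> min l m" "w i c \<noteq> 0" for i c
      using w[OF that(1), of "fst c" "snd c"] that(2) by (auto split: prod.splits)
    show "T.act (l + m - 2 * i) (w i) \<noteq> (\<lambda>_. 0)" if "i \<le> min l m" for i
      using top[OF that] by (simp add: act[OF that])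
    show "T.act (Suc (l + m - 2 * i)) (w i) = (\<lambda>_. 0)" if "i \<le> min l m" for i
      using zero[OF that] by (simp only: act[OF that])
    have "Suc (min l m) * Suc (l + m - min l m) = Suc l * Suc m"
      by (cases "l \<le> m") (simp_all add: min_def)
    then show "card (basis (comod_tensor q (V s l) (V t m))) = (\<Sum>i\<le>min l m. Suc (l + m - 2 * i))"
      by (simp add: B sum_string_lengths)
  qed
qed

text \<open>The decomposition is symmetric in the two factors, so one lemma used in both orders
  suffices and no braiding is constructed. The index stops at \<open>min l m\<close>, where the
  dimensions already add up to \<open>(l+1)(m+1)\<close>; for \<open>l <= m\<close> this is the
  range up to \<open>l\<close>.\<close>

theorem corollary4p6:
  fixes q :: "'k::{alg_closed_field, field_char_0}"
    and s t :: int
    and l m :: nat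
  assumes "q \<noteq> 0"
    and "q = 1 \<or> \<not> (\<exists>n>0. q ^ n = 1)"
  shows "comod_tensor q (V s l) (V t m)
           \<cong>\<^sub>c comod_dsum {0..min l m} (\<lambda>i. V (s + t + int i) (l + m - 2 * i)) \<and>
         comod_dsum {0..min l m} (\<lambda>i. V (s + t + int i) (l + m - 2 * i))
           \<cong>\<^sub>c comod_tensor q (V t m) (V s l)"
  using comod_iso_sym[OF dsum_iso_tensor[OF assms, of l m s t]] dsum_iso_tensor[OF assms, of m l t s]
  by (simp add: add.commute min.commute)

end
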